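(* Fix $N\ge 1$ and consider the composition of maps $$(\alpha_1,\dots,\alpha_N)\mapsto x=\gamma_2+\delta_2=1+\sum_{n=1}^N x_nz^n\mapsto f_+=-\log(x)\mapsto (f_1,\dots,f_N),$$ where $(\alpha_1,\dots,\alpha_N)\in\prod_{n=1}^N\Delta$. (a) For the bijective polynomial map $\mathbb C^N\to\mathbb C^N$, $f_+=\sum_{n=1}^N f_nz^n \mapsto (x_1,\dots,x_N)$, where $x_n$ is the coefficient of $z^n$ in $x=\exp(-f_+)$, $$\prod_{n=1}^N d\lambda(f_n)=\prod_{n=1}^N d\lambda(x_n).$$ (b) $$\chi_{\tilde D_N}(x_1,\dots,x_N)\prod_{n=1}^N d\lambda(x_n)=\prod_{n=1}^N(1-|\alpha_n|^2)^{n-1}d\lambda(\alpha_n),$$ where $\tilde D_N$ is the image of the map $(\alpha_1,\dots,\alpha_N)\mapsto (x_1,\dots,x_N)$. (c) $$\chi_{D_N}(f_1,\dots,f_N)\prod_{n=1}^N d\lambda(f_n)= \prod_{n=1}^N(1-|\alpha_n|^2)^{n-1} d\lambda(\alpha_n),$$ where $D_N$ is the image of the map $(\alpha_1,\dots,\alpha_N)\mapsto (f_1,\dots,f_N)$.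
   Context: $\Delta=\{z\in\mathbb C:|z|<1\}$, $\lambda$ is Lebesgue measure on $\mathbb C$, and $\chi_A$ is the characteristic function of $A$. Each displayed identity is an equality of measures under the indicated map (change of variables): the pushforward of the measure in the source variables equals the measure in the target variables. For a polynomial (or Laurent polynomial) $p$ in $z$, $p^*(z)=\overline{p(1/\bar z)}$; for a number, $*$ is complex conjugation. Given $\alpha_1,\dots,\alpha_N\in\Delta$, the polynomials $\gamma_2,\delta_2$ in $z$ are defined by $$\begin{pmatrix}\delta_2^*&\gamma_2^*\\ \gamma_2&\delta_2\end{pmatrix}=\begin{pmatrix}1&\alpha_N^*z^{-N}\\ \alpha_Nz^{N} & 1 \end{pmatrix}\cdots\begin{pmatrix}1&\alpha_2^*z^{-2}\\ \alpha_2z^{2} & 1 \end{pmatrix}\begin{pmatrix}1&\alpha_1^*z^{-1}\\ \alpha_1z & 1 \end{pmatrix}$$ (factors with larger index are to the left). Then $\gamma_2+\delta_2$ is a polynomial of degree at most $N$ with constant term $1$, written $1+\sum_{n=1}^N x_nz^n$. The numbers $f_1,\dots,f_N$ are the first $N$ Taylor coefficients at $0$ of $f_+=-\log x$ (with $f_+(0)=0$), $f_+(z)=\sum_{n\ge1}f_nz^n$. *)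

theory Defs
  imports "HOL-Complex_Analysis.Complex_Analysis" "HOL-Analysis.Analysis"
begin

section \<open>The polynomials \<open>\<gamma>\<^sub>2\<close>, \<open>\<delta>\<^sub>2\<close>\<close>

text \<open>\<open>p\<^sup>*\<close> is a Laurent polynomial in general, so it is represented by the function it induces
  on \<open>z \<noteq> 0\<close>; its value at \<open>0\<close> carries no meaning and is never used.\<close>

definition poly_star :: "complex poly \<Rightarrow> complex \<Rightarrow> complex" where
  "poly_star p z = cnj (poly p (1 / cnj z))"

definition matrix22 :: "complex \<Rightarrow> complex \<Rightarrow> complex \<Rightarrow> complex \<Rightarrow> complex^2^2" where
  "matrix22 a b c d = vector [vector [a, b], vector [c, d]]"

definition elem_factor :: "complex \<Rightarrow> nat \<Rightarrow> complex \<Rightarrow> complex^2^2" where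
  "elem_factor a n z = matrix22 1 (cnj a * z powi (- int n)) (a * z ^ n) 1"

fun factor_product :: "(nat \<Rightarrow> complex) \<Rightarrow> nat \<Rightarrow> complex \<Rightarrow> complex^2^2" where
  "factor_product \<alpha> 0 z = mat 1"
| "factor_product \<alpha> (Suc n) z = elem_factor (\<alpha> (Suc n)) (Suc n) z ** factor_product \<alpha> n z"

definition is_gamma_delta :: "nat \<Rightarrow> (nat \<Rightarrow> complex) \<Rightarrow> complex poly \<Rightarrow> complex poly \<Rightarrow> bool" where
  "is_gamma_delta N \<alpha> \<gamma> \<delta> \<longleftrightarrow>
     (\<forall>z. z \<noteq> 0 \<longrightarrow>
        matrix22 (poly_star \<delta> z) (poly_star \<gamma> z) (poly \<gamma> z) (poly \<delta> z) = factor_product \<alpha> N z)"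

text \<open>Existence and uniqueness of the pair are shown below (\<open>gamma_delta_correct\<close>,
  \<open>is_gamma_delta_unique\<close>).\<close>

definition gamma2 :: "nat \<Rightarrow> (nat \<Rightarrow> complex) \<Rightarrow> complex poly" where
  "gamma2 N \<alpha> = (THE \<gamma>. \<exists>\<delta>. is_gamma_delta N \<alpha> \<gamma> \<delta>)"

definition delta2 :: "nat \<Rightarrow> (nat \<Rightarrow> complex) \<Rightarrow> complex poly" where
  "delta2 N \<alpha> = (THE \<delta>. \<exists>\<gamma>. is_gamma_delta N \<alpha> \<gamma> \<delta>)"

definition x_poly :: "nat \<Rightarrow> (nat \<Rightarrow> complex) \<Rightarrow> complex poly" where
  "x_poly N \<alpha> = gamma2 N \<alpha> + delta2 N \<alpha>"

lemma matrix22_eq_iff: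
  "matrix22 a b c d = matrix22 a' b' c' d' \<longleftrightarrow> a = a' \<and> b = b' \<and> c = c' \<and> d = d'"
  by (simp add: matrix22_def vec_eq_iff forall_2)

lemma matrix22_mult:
  "matrix22 a b c d ** matrix22 a' b' c' d' =
     matrix22 (a*a' + b*c') (a*b' + b*d') (c*a' + d*c') (c*b' + d*d')"
  by (simp add: matrix22_def vec_eq_iff forall_2 matrix_matrix_mult_def sum_2)

lemma mat_1_eq_matrix22: "mat 1 = matrix22 1 0 0 1"
  by (simp add: matrix22_def vec_eq_iff forall_2 mat_def)

lemma poly_eqI_nonzero:
  fixes p q :: "complex poly"
  assumes "\<And>z. z \<noteq> 0 \<Longrightarrow> poly p z = poly q z"
  shows "p = q"
proof -
  have "poly ([:0, 1:] * p) z = poly ([:0, 1:] * q) z" for z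
    using assms[of z] by (cases "z = 0") auto
  then have "[:0, 1:] * p = [:0, 1:] * q"
    by (simp add: poly_eq_poly_eq_iff[symmetric] fun_eq_iff)
  then show ?thesis
    by (subst (asm) mult_left_cancel) auto
qed

lemma is_gamma_delta_unique:
  assumes "is_gamma_delta N \<alpha> \<gamma> \<delta>" and "is_gamma_delta N \<alpha> \<gamma>' \<delta>'"
  shows "\<gamma> = \<gamma>'" and "\<delta> = \<delta>'"
proof -
  have "poly \<gamma> z = poly \<gamma>' z \<and> poly \<delta> z = poly \<delta>' z" if "z \<noteq> 0" for z
    using assms[unfolded is_gamma_delta_def, rule_format, OF that]
    by (metis matrix22_eq_iff)
  then show "\<gamma> = \<gamma>'" and "\<delta> = \<delta>'"
    by (blast intro: poly_eqI_nonzero)+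
qed

definition star_shift :: "nat \<Rightarrow> complex poly \<Rightarrow> complex poly" where
  "star_shift n p = (\<Sum>k\<le>n. monom (cnj (coeff p (n - k))) k)"

lemma coeff_star_shift: "coeff (star_shift n p) k = (if k \<le> n then cnj (coeff p (n - k)) else 0)"
  by (simp add: star_shift_def coeff_sum if_distrib sum.delta cong: if_cong)

lemma poly_star_shift:
  assumes "degree p \<le> n" and "z \<noteq> 0"
  shows "poly (star_shift n p) z = z ^ n * poly_star p z"
proof -
  have "poly (star_shift n p) z = (\<Sum>k\<le>n. cnj (coeff p (n - k)) * z ^ k)"
    by (simp add: star_shift_def poly_sum poly_monom)
  also have "\<dots> = (\<Sum>k\<le>n. cnj (coeff p k) * z ^ (n - k))"
    by (rule sum.reindex_bij_witness[of _ "\<lambda>k. n - k" "\<lambda>k. n - k"]) auto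
  also have "\<dots> = (\<Sum>k\<le>n. z ^ n * (cnj (coeff p k) * (1 / z) ^ k))"
    using assms(2) by (intro sum.cong) (auto simp: power_diff power_one_over divide_simps)
  also have "\<dots> = z ^ n * cnj (\<Sum>k\<le>n. coeff p k * (1 / cnj z) ^ k)"
    by (simp add: sum_distrib_left)
  also have "(\<Sum>k\<le>n. coeff p k * (1 / cnj z) ^ k) = poly p (1 / cnj z)"
    unfolding poly_altdef using assms(1)
    by (intro sum.mono_neutral_right) (auto simp: coeff_eq_0)
  finally show ?thesis by (simp add: poly_star_def)
qed

lemma is_gamma_delta_exists:
  "\<exists>\<gamma> \<delta>. is_gamma_delta N \<alpha> \<gamma> \<delta> \<and> degree \<gamma> \<le> N \<and> degree \<delta> \<le> N \<and> coeff \<gamma> 0 = 0 \<and> coeff \<delta> 0 = 1"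
proof (induction N)
  case 0
  have "is_gamma_delta 0 \<alpha> 0 1"
    by (simp add: is_gamma_delta_def mat_1_eq_matrix22 poly_star_def)
  then show ?case by (intro exI[of _ 0] exI[of _ 1]) auto
next
  case (Suc N)
  then obtain \<gamma> \<delta> where gd: "is_gamma_delta N \<alpha> \<gamma> \<delta>" "degree \<gamma> \<le> N" "degree \<delta> \<le> N"
      "coeff \<gamma> 0 = 0" "coeff \<delta> 0 = 1" by blast
  define a where "a = \<alpha> (Suc N)"
  define \<gamma>' where "\<gamma>' = \<gamma> + smult a (star_shift (Suc N) \<delta>)"
  define \<delta>' where "\<delta>' = \<delta> + smult a (star_shift (Suc N) \<gamma>)"
  have pg: "poly \<gamma>' z = poly \<gamma> z + a * z ^ Suc N * poly_star \<delta> z"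
    and pd: "poly \<delta>' z = poly \<delta> z + a * z ^ Suc N * poly_star \<gamma> z" if "z \<noteq> 0" for z
    using gd(2,3) that by (simp_all add: \<gamma>'_def \<delta>'_def poly_star_shift)
  have "is_gamma_delta (Suc N) \<alpha> \<gamma>' \<delta>'"
    unfolding is_gamma_delta_def
  proof (intro allI impI)
    fix z :: complex assume z: "z \<noteq> 0"
    have pw: "z powi (- int (Suc N)) = 1 / z ^ Suc N"
      by (simp add: power_int_minus divide_inverse del: of_nat_Suc power_Suc)
    have star2: "poly_star p (1 / cnj z) = cnj (poly p z)" for p
      by (simp add: poly_star_def)
    have sg: "poly_star \<gamma>' z = poly_star \<gamma> z + cnj a * (1 / z ^ Suc N) * poly \<delta> z"
      and sd: "poly_star \<delta>' z = poly_star \<delta> z + cnj a * (1 / z ^ Suc N) * poly \<gamma> z"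
      using z pg[of "1 / cnj z"] pd[of "1 / cnj z"]
      by (simp_all add: poly_star_def[of \<gamma>'] poly_star_def[of \<delta>'] star2 power_one_over
          del: power_Suc)
        (simp_all add: poly_star_def)
    have "factor_product \<alpha> (Suc N) z = elem_factor a (Suc N) z **
        matrix22 (poly_star \<delta> z) (poly_star \<gamma> z) (poly \<gamma> z) (poly \<delta> z)"
      using gd(1) z by (simp add: a_def is_gamma_delta_def)
    then show "matrix22 (poly_star \<delta>' z) (poly_star \<gamma>' z) (poly \<gamma>' z) (poly \<delta>' z) =
        factor_product \<alpha> (Suc N) z"
      unfolding elem_factor_def pw matrix22_mult
      by (simp add: matrix22_eq_iff sg sd pg[OF z] pd[OF z] del: power_Suc)
  qed
  moreover have "degree \<gamma>' \<le> Suc N" "degree \<delta>' \<le> Suc N"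
    using gd(2,3) by (auto intro!: degree_le simp: \<gamma>'_def \<delta>'_def coeff_star_shift coeff_eq_0)
  moreover have "coeff \<gamma>' 0 = 0" "coeff \<delta>' 0 = 1"
    using gd by (simp_all add: \<gamma>'_def \<delta>'_def coeff_star_shift coeff_eq_0)
  ultimately show ?case by blast
qed

lemma gamma_delta_correct: "is_gamma_delta N \<alpha> (gamma2 N \<alpha>) (delta2 N \<alpha>)"
proof -
  obtain \<gamma> \<delta> where gd: "is_gamma_delta N \<alpha> \<gamma> \<delta>"
    using is_gamma_delta_exists by blast
  have "gamma2 N \<alpha> = \<gamma>" "delta2 N \<alpha> = \<delta>"
    unfolding gamma2_def delta2_def
    by (rule the_equality; use gd is_gamma_delta_unique in blast)+
  with gd show ?thesis by simp
qed

lemma degree_x_poly: "degree (x_poly N \<alpha>) \<le> N"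
  and coeff_x_poly_0: "coeff (x_poly N \<alpha>) 0 = 1"
proof -
  obtain \<gamma> \<delta> where gd: "is_gamma_delta N \<alpha> \<gamma> \<delta>" "degree \<gamma> \<le> N" "degree \<delta> \<le> N"
      "coeff \<gamma> 0 = 0" "coeff \<delta> 0 = 1"
    using is_gamma_delta_exists by blast
  then have "x_poly N \<alpha> = \<gamma> + \<delta>"
    using is_gamma_delta_unique[OF gd(1) gamma_delta_correct] by (simp add: x_poly_def)
  with gd show "degree (x_poly N \<alpha>) \<le> N" "coeff (x_poly N \<alpha>) 0 = 1"
    by (simp_all add: degree_add_le)
qed


section \<open>The maps on coordinates\<close>

text \<open>A point of \<open>\<complex>\<^sup>N\<close> is an extensional function on \<open>{1..N}\<close>, i.e. an element of
  \<open>complex_space N\<close>.\<close>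

abbreviation complex_space :: "nat \<Rightarrow> (nat \<Rightarrow> complex) set" where
  "complex_space N \<equiv> {1..N} \<rightarrow>\<^sub>E UNIV"

abbreviation polydisc :: "nat \<Rightarrow> (nat \<Rightarrow> complex) set" where
  "polydisc N \<equiv> {1..N} \<rightarrow>\<^sub>E ball 0 1"

definition alpha_to_x :: "nat \<Rightarrow> (nat \<Rightarrow> complex) \<Rightarrow> nat \<Rightarrow> complex" where
  "alpha_to_x N \<alpha> = (\<lambda>n\<in>{1..N}. coeff (x_poly N \<alpha>) n)"

text \<open>Since \<open>x(0) = 1\<close>, the principal branch gives the germ of \<open>- log x\<close> at \<open>0\<close> that vanishes
  at \<open>0\<close>; only this germ enters the Taylor coefficients.\<close>

definition f_plus :: "complex poly \<Rightarrow> complex \<Rightarrow> complex" where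
  "f_plus x z = - Ln (poly x z)"

definition alpha_to_f :: "nat \<Rightarrow> (nat \<Rightarrow> complex) \<Rightarrow> nat \<Rightarrow> complex" where
  "alpha_to_f N \<alpha> = (\<lambda>n\<in>{1..N}. fps_nth (fps_expansion (f_plus (x_poly N \<alpha>)) 0) n)"

definition f_to_x :: "nat \<Rightarrow> (nat \<Rightarrow> complex) \<Rightarrow> nat \<Rightarrow> complex" where
  "f_to_x N f = (\<lambda>n\<in>{1..N}. fps_nth (fps_expansion (\<lambda>z. exp (- (\<Sum>k=1..N. f k * z ^ k))) 0) n)"

text \<open>Complex polynomial functions of the coordinates with index in \<open>I\<close>, in the style of
  \<^const>\<open>real_polynomial_function\<close>, and maps with such components.\<close>

inductive coord_polynomial :: "nat set \<Rightarrow> ((nat \<Rightarrow> complex) \<Rightarrow> complex) \<Rightarrow> bool" for I where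
  const: "coord_polynomial I (\<lambda>v. c)"
| coord: "i \<in> I \<Longrightarrow> coord_polynomial I (\<lambda>v. v i)"
| add: "coord_polynomial I p \<Longrightarrow> coord_polynomial I q \<Longrightarrow> coord_polynomial I (\<lambda>v. p v + q v)"
| mult: "coord_polynomial I p \<Longrightarrow> coord_polynomial I q \<Longrightarrow> coord_polynomial I (\<lambda>v. p v * q v)"

definition polynomial_map :: "nat \<Rightarrow> ((nat \<Rightarrow> complex) \<Rightarrow> nat \<Rightarrow> complex) \<Rightarrow> bool" where
  "polynomial_map N F \<longleftrightarrow> (\<forall>n\<in>{1..N}. coord_polynomial {1..N} (\<lambda>v. F v n))"


section \<open>The measures\<close>

definition lebesgue_CN :: "nat \<Rightarrow> (nat \<Rightarrow> complex) measure" where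
  "lebesgue_CN N = (\<Pi>\<^sub>M n\<in>{1..N}. lborel)"

definition alpha_measure :: "nat \<Rightarrow> (nat \<Rightarrow> complex) measure" where
  "alpha_measure N = (\<Pi>\<^sub>M n\<in>{1..N}.
     density lborel (\<lambda>a. ennreal ((1 - (cmod a)\<^sup>2) ^ (n - 1)) * indicator (ball 0 1) a))"

end

theory Submission
  imports Defs
begin

text \<open>For (b), the polynomial for \<open>N + 1\<close> arises from the one for \<open>N\<close> by the Szego recursion
  \<open>x\<^sub>k \<mapsto> x\<^sub>k + \<alpha> x\<^sup>*\<^bsub>N+1-k\<^esub>\<close> for \<open>1 \<le> k \<le> N\<close>, together with \<open>x\<^bsub>N+1\<^esub> = \<alpha>\<close>, where \<open>\<alpha> = \<alpha>\<^bsub>N+1\<^esub>\<close>. For fixed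
  \<open>\<alpha>\<close> this is an invertible real-linear map with Jacobian \<open>(1 - |\<alpha>|\<^sup>2)\<^sup>N\<close>: it couples only \<open>x\<^sub>k\<close> and
  \<open>x\<^bsub>N+1-k\<^esub>\<close>, and such a pair contributes \<open>(1 - |\<alpha>|\<^sup>2)\<^sup>2\<close>, a coefficient coupled to itself
  \<open>1 - |\<alpha>|\<^sup>2\<close>. Tonelli and induction on \<open>N\<close> give (b). For (a), the coefficient form of
  \<open>x' = - f\<^sub>+' x\<close> says that \<open>x\<^sub>n + f\<^sub>n\<close> is a polynomial in coordinates of lower index, so the map is
  triangular in both directions with \<open>-1\<close> on the diagonal. (c) combines the two.\<close>


section \<open>Jacobians of real-linear maps\<close>

lemma borel_measurable_cnj [measurable]: "cnj \<in> borel_measurable borel"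
  by (intro borel_measurable_continuous_onI continuous_intros)

text \<open>Boxes determine Lebesgue measure, and the preimage of a complex box is a product of two
  real intervals. This opens integrals over the plane to one-dimensional substitutions.\<close>

lemma lborel_complex_eq_distr:
  "(lborel :: complex measure) = distr (lborel \<Otimes>\<^sub>M lborel) borel (\<lambda>(s, t). Complex s t)"
proof (rule lborel_eqI)
  have [measurable]: "(\<lambda>(s, t). Complex s t) \<in> borel_measurable (borel \<Otimes>\<^sub>M borel)"
    unfolding Complex_eq by measurable
  fix l u :: complex
  assume lu: "\<And>b. b \<in> Basis \<Longrightarrow> l \<bullet> b \<le> u \<bullet> b"
  have le: "Re l \<le> Re u" "Im l \<le> Im u"
    using lu[of 1] lu[of \<i>] by (simp_all add: Basis_complex_def)
  have "(\<lambda>(s, t). Complex s t) -` box l u \<inter> space (lborel \<Otimes>\<^sub>M lborel)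
      = {Re l<..<Re u} \<times> {Im l<..<Im u}"
    by (auto simp: box_def Basis_complex_def space_pair_measure)
  then show "emeasure (distr (lborel \<Otimes>\<^sub>M lborel) borel (\<lambda>(s, t). Complex s t)) (box l u) =
      (\<Prod>b\<in>Basis. (u - l) \<bullet> b)"
    using le by (simp add: emeasure_distr lborel.emeasure_pair_measure_Times Basis_complex_def
        ennreal_mult)
qed simp

lemma nn_integral_complex:
  assumes [measurable]: "g \<in> borel_measurable borel"
  shows "(\<integral>\<^sup>+ z. g z \<partial>lborel) = (\<integral>\<^sup>+ s. \<integral>\<^sup>+ t. g (Complex s t) \<partial>lborel \<partial>lborel)"
proof -
  have [measurable]: "(\<lambda>(s, t). Complex s t) \<in> borel_measurable (borel \<Otimes>\<^sub>M borel)"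
    unfolding Complex_eq by measurable
  show ?thesis
    by (subst lborel_complex_eq_distr)
      (simp add: nn_integral_distr lborel.nn_integral_fst[symmetric] case_prod_beta)
qed

text \<open>The exponent 2 is the real dimension of the plane. A real factor suffices for the later
  eliminations, where \<open>c\<close> is 1, -1 or \<open>1 - |a|^2\<close>.\<close>

lemma nn_integral_complex_affine:
  fixes g :: "complex \<Rightarrow> ennreal"
  assumes [measurable]: "g \<in> borel_measurable borel" and c: "c \<noteq> (0::real)"
  shows "(\<integral>\<^sup>+ z. g z \<partial>lborel) = ennreal (c\<^sup>2) * (\<integral>\<^sup>+ z. g (b + complex_of_real c * z) \<partial>lborel)"
  by (subst lborel_affine[OF c, of b])
    (simp add: nn_integral_density nn_integral_distr nn_integral_cmult scaleR_conv_of_real)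

text \<open>In real coordinates \<open>z \<mapsto> z + a cnj z\<close> is a shear followed by scaling, one coordinate at a time;
  with \<open>p = Re a\<close> the factors are \<open>1 + p\<close> and \<open>(1 - |a|\<^sup>2) / (1 + p)\<close>.\<close>

lemma nn_integral_add_cnj:
  assumes [measurable]: "g \<in> borel_measurable borel" and a: "cmod a < 1"
  shows "ennreal (1 - (cmod a)\<^sup>2) * (\<integral>\<^sup>+ z. g (z + a * cnj z) \<partial>lborel) = (\<integral>\<^sup>+ z. g z \<partial>lborel)"
proof -
  define p q r where "p = Re a" and "q = Im a" and "r = 1 - (cmod a)\<^sup>2"
  have r: "r > 0" using a by (simp add: r_def power_less_one_iff abs_square_less_1)
  have "\<bar>p\<bar> < 1" using a abs_Re_le_cmod[of a] by (simp add: p_def)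
  then have p: "1 + p > 0" by simp
  \<comment> \<open>The determinant of the real matrix with rows \<open>(1 + p, q)\<close> and
    \<open>(q, 1 - p)\<close>, which represents \<open>z + a * cnj z\<close>.\<close>
  have pq: "(1 - p) * (1 + p) - q * q = r"
    using cmod_power2[of a] by (simp add: p_def q_def r_def power2_eq_square algebra_simps)
  have [measurable]: "(\<lambda>(s, t). Complex s t) \<in> borel_measurable (borel \<Otimes>\<^sub>M borel)"
    unfolding Complex_eq by measurable
  define h where "h = (\<lambda>s t. g (Complex s t))"
  have [measurable]: "case_prod h \<in> borel_measurable (borel \<Otimes>\<^sub>M borel)"
    unfolding h_def by measurable
  have 1: "g (Complex s t + a * cnj (Complex s t)) = h (q * t + (1 + p) * s) (q * s + (1 - p) * t)" for s t
    by (simp add: h_def p_def q_def complex_eq_iff algebra_simps flip: complex_eq_iff)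
       (auto intro!: arg_cong[of _ _ g] simp: complex_eq_iff algebra_simps)
  \<comment> \<open>Elimination: \<open>s\<close> is expressed through the new first coordinate
    \<open>s' = q * t + (1 + p) * s\<close>, which leaves the coefficient \<open>r / (1 + p)\<close>
    for \<open>t\<close>.\<close>
  have e1: "q * s + (1 - p) * t = (q * (q * t + (1 + p) * s) + r * t) / (1 + p)" for s t
    using p by (simp add: field_simps flip: pq)
  define k where "k = (\<lambda>s' t. h s' ((q * s' + r * t) / (1 + p)))"
  have [measurable]: "case_prod k \<in> borel_measurable (borel \<Otimes>\<^sub>M borel)"
    unfolding k_def by measurable
  have "(\<integral>\<^sup>+ z. g (z + a * cnj z) \<partial>lborel) = (\<integral>\<^sup>+ s. \<integral>\<^sup>+ t. k (q * t + (1 + p) * s) t \<partial>lborel \<partial>lborel)"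
    by (subst nn_integral_complex) (simp_all add: 1 e1 k_def)
  \<comment> \<open>For fixed \<open>t\<close> the first argument of \<open>k\<close> is affine in
    \<open>s\<close> with slope \<open>1 + p\<close>, so the \<open>s\<close>-integral has to be the
    inner one for the substitution.\<close>
  also have "\<dots> = (\<integral>\<^sup>+ t. \<integral>\<^sup>+ s. k (q * t + (1 + p) * s) t \<partial>lborel \<partial>lborel)"
    by (rule lborel_pair.Fubini') measurable
  finally have "ennreal (1 + p) * (\<integral>\<^sup>+ z. g (z + a * cnj z) \<partial>lborel)
      = (\<integral>\<^sup>+ t. ennreal (1 + p) * (\<integral>\<^sup>+ s. k (q * t + (1 + p) * s) t \<partial>lborel) \<partial>lborel)"
    by (simp add: nn_integral_cmult)
  also have "\<dots> = (\<integral>\<^sup>+ t. \<integral>\<^sup>+ s. k s t \<partial>lborel \<partial>lborel)"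
  proof (rule nn_integral_cong)
    fix t
    show "ennreal (1 + p) * (\<integral>\<^sup>+ s. k (q * t + (1 + p) * s) t \<partial>lborel) = (\<integral>\<^sup>+ s. k s t \<partial>lborel)"
      using p nn_integral_real_affine[of "\<lambda>s. k s t" "1 + p" "q * t"] by simp
  qed
  also have "\<dots> = (\<integral>\<^sup>+ s. \<integral>\<^sup>+ t. k s t \<partial>lborel \<partial>lborel)"
    by (rule lborel_pair.Fubini') measurable
  finally have A: "ennreal (1 + p) * (\<integral>\<^sup>+ z. g (z + a * cnj z) \<partial>lborel) = (\<integral>\<^sup>+ s. \<integral>\<^sup>+ t. k s t \<partial>lborel \<partial>lborel)" .
  have "(\<integral>\<^sup>+ z. g z \<partial>lborel) = (\<integral>\<^sup>+ s. \<integral>\<^sup>+ t. h s t \<partial>lborel \<partial>lborel)"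
    by (simp add: nn_integral_complex h_def)
  also have "\<dots> = (\<integral>\<^sup>+ s. ennreal (r / (1 + p)) * (\<integral>\<^sup>+ t. k s t \<partial>lborel) \<partial>lborel)"
  proof (rule nn_integral_cong)
    fix s
    show "(\<integral>\<^sup>+ t. h s t \<partial>lborel) = ennreal (r / (1 + p)) * (\<integral>\<^sup>+ t. k s t \<partial>lborel)"
      using p r by (subst nn_integral_real_affine[of _ "r / (1 + p)" "q * s / (1 + p)"])
        (auto simp: k_def add_divide_distrib)
  qed
  also have "\<dots> = ennreal (r / (1 + p)) * (ennreal (1 + p) * (\<integral>\<^sup>+ z. g (z + a * cnj z) \<partial>lborel))"
    by (simp add: nn_integral_cmult A)
  also have "\<dots> = ennreal r * (\<integral>\<^sup>+ z. g (z + a * cnj z) \<partial>lborel)"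
    using p r by (simp add: mult.assoc[symmetric] ennreal_mult[symmetric])
  finally show ?thesis by (simp add: r_def)
qed

text \<open>Block elimination: with \<open>u = x + a * cnj y\<close> the second component is
  \<open>a * cnj u + (1 - |a|^2) * y\<close>. So \<open>x\<close> is only translated and
  \<open>y\<close> is scaled by a real factor, which counts squared in the plane.\<close>

lemma nn_integral_add_cnj_pair:
  assumes [measurable]: "case_prod g \<in> borel_measurable (borel \<Otimes>\<^sub>M borel)" and a: "cmod a < 1"
  shows "ennreal ((1 - (cmod a)\<^sup>2)\<^sup>2) *
      (\<integral>\<^sup>+ y. \<integral>\<^sup>+ x. g (x + a * cnj y) (y + a * cnj x) \<partial>lborel \<partial>lborel) =
    (\<integral>\<^sup>+ y. \<integral>\<^sup>+ x. g x y \<partial>lborel \<partial>lborel)"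
proof -
  define r where "r = 1 - (cmod a)\<^sup>2"
  have r: "r \<noteq> 0" using a by (simp add: r_def power2_eq_1_iff) (use norm_ge_zero[of a] in linarith)
  have aa: "a * cnj a = complex_of_real (1 - r)"
    using complex_norm_square[of a] by (simp add: r_def)
  define k where "k = (\<lambda>u y. g u (a * cnj u + of_real r * y))"
  have [measurable]: "case_prod k \<in> borel_measurable (borel \<Otimes>\<^sub>M borel)"
    unfolding k_def by measurable
  have 1: "g (x + a * cnj y) (y + a * cnj x) = k (a * cnj y + of_real 1 * x) y" for x y
  proof -
    have "a * cnj (a * cnj y + x) + of_real r * y = a * cnj a * y + a * cnj x + of_real r * y"
      by (simp add: algebra_simps)
    also have "\<dots> = y + a * cnj x" unfolding aa by (simp add: algebra_simps)
    finally show ?thesis by (simp add: k_def add.commute)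
  qed
  have "(\<integral>\<^sup>+ y. \<integral>\<^sup>+ x. g (x + a * cnj y) (y + a * cnj x) \<partial>lborel \<partial>lborel) =
      (\<integral>\<^sup>+ y. \<integral>\<^sup>+ x. k x y \<partial>lborel \<partial>lborel)"
  proof (rule nn_integral_cong)
    fix y
    show "(\<integral>\<^sup>+ x. g (x + a * cnj y) (y + a * cnj x) \<partial>lborel) = (\<integral>\<^sup>+ x. k x y \<partial>lborel)"
      using nn_integral_complex_affine[of "\<lambda>x. k x y" 1 "a * cnj y"] by (simp add: 1)
  qed
  also have "\<dots> = (\<integral>\<^sup>+ x. \<integral>\<^sup>+ y. k x y \<partial>lborel \<partial>lborel)"
    by (rule lborel_pair.Fubini') measurable
  finally have "ennreal (r\<^sup>2) * (\<integral>\<^sup>+ y. \<integral>\<^sup>+ x. g (x + a * cnj y) (y + a * cnj x) \<partial>lborel \<partial>lborel) =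
      (\<integral>\<^sup>+ x. ennreal (r\<^sup>2) * (\<integral>\<^sup>+ y. k x y \<partial>lborel) \<partial>lborel)"
    by (simp add: nn_integral_cmult)
  also have "\<dots> = (\<integral>\<^sup>+ x. \<integral>\<^sup>+ y. g x y \<partial>lborel \<partial>lborel)"
  proof (rule nn_integral_cong)
    fix x
    show "ennreal (r\<^sup>2) * (\<integral>\<^sup>+ y. k x y \<partial>lborel) = (\<integral>\<^sup>+ y. g x y \<partial>lborel)"
      using r nn_integral_complex_affine[of "g x" r "a * cnj x"] by (simp add: k_def)
  qed
  also have "\<dots> = (\<integral>\<^sup>+ y. \<integral>\<^sup>+ x. g x y \<partial>lborel \<partial>lborel)"
    by (rule lborel_pair.Fubini'[symmetric]) measurable
  finally show ?thesis by (simp add: r_def)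
qed

lemma product_sigma_finite_lborel: "product_sigma_finite (\<lambda>_. lborel :: complex measure)"
  by standard

lemma measurable_restrict_add_cnj:
  assumes "\<And>i. i \<in> I \<Longrightarrow> \<sigma> i \<in> I"
  shows "(\<lambda>v. \<lambda>i\<in>I. v i + a * cnj (v (\<sigma> i)))
    \<in> Pi\<^sub>M I (\<lambda>_. lborel) \<rightarrow>\<^sub>M Pi\<^sub>M I (\<lambda>_. lborel)"
proof (rule measurable_restrict)
  fix i assume i: "i \<in> I"
  have [measurable]: "(\<lambda>v. v i) \<in> borel_measurable (Pi\<^sub>M I (\<lambda>_. lborel))"
    "(\<lambda>v. v (\<sigma> i)) \<in> borel_measurable (Pi\<^sub>M I (\<lambda>_. lborel))"
    using measurable_component_singleton[of i I "\<lambda>_. lborel"]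
      measurable_component_singleton[of "\<sigma> i" I "\<lambda>_. lborel"] i assms[OF i] by simp_all
  show "(\<lambda>v. v i + a * cnj (v (\<sigma> i))) \<in> Pi\<^sub>M I (\<lambda>_. lborel) \<rightarrow>\<^sub>M lborel"
    by simp
qed

text \<open>The orbits of the involution \<open>\<sigma>\<close> decouple, so they can be integrated out one by one.\<close>

lemma nn_integral_PiM_add_cnj:
  fixes I :: "'i set" and \<sigma> :: "'i \<Rightarrow> 'i"
  assumes "finite I" and "\<And>i. i \<in> I \<Longrightarrow> \<sigma> i \<in> I" and "\<And>i. i \<in> I \<Longrightarrow> \<sigma> (\<sigma> i) = i"
    and a: "cmod a < 1"
    and "g \<in> borel_measurable (Pi\<^sub>M I (\<lambda>_. lborel))"
  shows "ennreal ((1 - (cmod a)\<^sup>2) ^ card I) *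
      (\<integral>\<^sup>+ v. g (\<lambda>i\<in>I. v i + a * cnj (v (\<sigma> i))) \<partial>Pi\<^sub>M I (\<lambda>_. lborel)) =
    (\<integral>\<^sup>+ v. g v \<partial>Pi\<^sub>M I (\<lambda>_. lborel))"
  using assms(1,2,3,5)
\<comment> \<open>Removing an orbit takes away one or two points, hence induction over proper
  subsets. \<open>g\<close> varies because the integral over the removed coordinates becomes the new
  integrand.\<close>
proof (induction I arbitrary: g rule: finite_psubset_induct)
  case (psubset I)
  interpret product_sigma_finite "\<lambda>_. lborel :: complex measure"
    by (rule product_sigma_finite_lborel)
  define c where "c = 1 - (cmod a)\<^sup>2"
  have c: "c \<ge> 0" using a by (simp add: c_def abs_square_le_1)
  define T where "T J v = (\<lambda>i\<in>J. v i + a * cnj (v (\<sigma> i)))" for J v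
  note [measurable] = psubset.prems(3)
  show ?case
  proof (cases "I = {}")
    case True
    then show ?thesis by (simp add: PiM_empty nn_integral_count_space_finite)
  next
    case False
    then obtain i where i: "i \<in> I" by auto
    show ?thesis
    proof (cases "\<sigma> i = i")
      case fixed: True
      define J where "J = I - {i}"
      have J: "I = insert i J" "i \<notin> J" "finite J" "J \<subset> I"
        using i psubset.hyps by (auto simp: J_def)
      have \<sigma>: "\<sigma> k \<in> J" "\<sigma> (\<sigma> k) = k" if "k \<in> J" for k
        using that psubset.prems(1,2)[of k] fixed by (auto simp: J_def)
      have TJ [measurable]: "T J \<in> Pi\<^sub>M J (\<lambda>_. lborel) \<rightarrow>\<^sub>M Pi\<^sub>M J (\<lambda>_. lborel)"
        unfolding T_def using \<sigma>(1) by (rule measurable_restrict_add_cnj)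
      have TI [measurable]: "T I \<in> Pi\<^sub>M I (\<lambda>_. lborel) \<rightarrow>\<^sub>M Pi\<^sub>M I (\<lambda>_. lborel)"
        unfolding T_def using psubset.prems(1) by (rule measurable_restrict_add_cnj)
      define h where "h = (\<lambda>w t. g (w(i := t)))"
      have [measurable]: "case_prod h \<in> borel_measurable (Pi\<^sub>M J (\<lambda>_. lborel) \<Otimes>\<^sub>M borel)"
      proof -
        have "(\<lambda>p. (fst p)(i := snd p)) \<in> Pi\<^sub>M J (\<lambda>_. lborel) \<Otimes>\<^sub>M borel \<rightarrow>\<^sub>M Pi\<^sub>M I (\<lambda>_. lborel)"
          by (rule measurable_fun_upd[where J = J]) (use J in auto)
        from measurable_compose[OF this psubset.prems(3)] show ?thesis
          by (simp only: h_def case_prod_beta')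
      qed
      \<comment> \<open>As \<open>i\<close> is a fixed point of \<sigma>, the new value at
        \<open>i\<close> involves only \<open>t\<close>, and the map on \<open>J\<close> does not
        see \<open>t\<close>.\<close>
      have Tupd: "T I (v(i := t)) = (T J v)(i := t + a * cnj t)" for v t
        using J fixed \<sigma> by (auto simp: T_def fun_eq_iff restrict_def)
      have cc: "ennreal (c ^ card I) = ennreal (c ^ card J) * ennreal c"
        using c J by (simp add: ennreal_mult mult.commute)
      have step: "ennreal c * (\<integral>\<^sup>+ t. h (T J v) (t + a * cnj t) \<partial>lborel) = (\<integral>\<^sup>+ t. h (T J v) t \<partial>lborel)"
        if "v \<in> space (Pi\<^sub>M J (\<lambda>_. lborel))" for v
      proof -
        have "T J v \<in> space (Pi\<^sub>M J (\<lambda>_. lborel))"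
          using measurable_space[OF TJ that] .
        then have "h (T J v) \<in> borel_measurable borel"
          using measurable_Pair2[of "case_prod h"] by simp
        then show ?thesis
          unfolding c_def using a by (rule nn_integral_add_cnj)
      qed
      have "(\<integral>\<^sup>+ v. g (T I v) \<partial>Pi\<^sub>M I (\<lambda>_. lborel)) =
          (\<integral>\<^sup>+ v. \<integral>\<^sup>+ t. g (T I (v(i := t))) \<partial>lborel \<partial>Pi\<^sub>M J (\<lambda>_. lborel))"
        unfolding J(1) by (rule product_nn_integral_insert) (use J(1-3) in \<open>simp_all flip: J(1)\<close>)
      also have "\<dots> = (\<integral>\<^sup>+ v. \<integral>\<^sup>+ t. h (T J v) (t + a * cnj t) \<partial>lborel \<partial>Pi\<^sub>M J (\<lambda>_. lborel))"
        by (simp add: Tupd h_def)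
      finally have "ennreal c * (\<integral>\<^sup>+ v. g (T I v) \<partial>Pi\<^sub>M I (\<lambda>_. lborel)) =
          (\<integral>\<^sup>+ v. ennreal c * (\<integral>\<^sup>+ t. h (T J v) (t + a * cnj t) \<partial>lborel) \<partial>Pi\<^sub>M J (\<lambda>_. lborel))"
        by (simp add: nn_integral_cmult)
      also have "\<dots> = (\<integral>\<^sup>+ v. \<integral>\<^sup>+ t. h (T J v) t \<partial>lborel \<partial>Pi\<^sub>M J (\<lambda>_. lborel))"
        by (intro nn_integral_cong step)
      finally have "ennreal (c ^ card I) * (\<integral>\<^sup>+ v. g (T I v) \<partial>Pi\<^sub>M I (\<lambda>_. lborel)) =
          ennreal (c ^ card J) * (\<integral>\<^sup>+ v. \<integral>\<^sup>+ t. h (T J v) t \<partial>lborel \<partial>Pi\<^sub>M J (\<lambda>_. lborel))"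
        using cc by (simp only: mult.assoc)
      also have "\<dots> = (\<integral>\<^sup>+ v. \<integral>\<^sup>+ t. h v t \<partial>lborel \<partial>Pi\<^sub>M J (\<lambda>_. lborel))"
        unfolding c_def T_def using J(4) \<sigma> by (intro psubset.IH) measurable
      also have "\<dots> = (\<integral>\<^sup>+ v. g v \<partial>Pi\<^sub>M I (\<lambda>_. lborel))"
        unfolding J(1) h_def
        by (rule product_nn_integral_insert[symmetric]) (use J(1-3) in \<open>simp_all flip: J(1)\<close>)
      finally show ?thesis by (simp only: c_def T_def)
    next
      case moved: False
      define j where "j = \<sigma> i"
      have ij: "i \<noteq> j" "j \<in> I" "\<sigma> i = j" "\<sigma> j = i"
        using moved i psubset.prems(1,2)[of i] by (auto simp: j_def)
      define J where "J = I - {i, j}"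
      have J: "I = insert i (insert j J)" "i \<notin> J" "j \<notin> J" "finite J" "J \<subset> I"
        using i ij psubset.hyps by (auto simp: J_def)
      have \<sigma>: "\<sigma> k \<in> J" "\<sigma> (\<sigma> k) = k" if "k \<in> J" for k
      proof -
        have k: "k \<in> I" "k \<noteq> i" "k \<noteq> j" using that by (auto simp: J_def)
        show "\<sigma> (\<sigma> k) = k" using k psubset.prems(2) by blast
        then have "\<sigma> k \<noteq> i" "\<sigma> k \<noteq> j" using k ij by metis+
        then show "\<sigma> k \<in> J" using k psubset.prems(1) by (auto simp: J_def)
      qed
      have TJ [measurable]: "T J \<in> Pi\<^sub>M J (\<lambda>_. lborel) \<rightarrow>\<^sub>M Pi\<^sub>M J (\<lambda>_. lborel)"
        unfolding T_def using \<sigma>(1) by (rule measurable_restrict_add_cnj)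
      have TI [measurable]: "T I \<in> Pi\<^sub>M I (\<lambda>_. lborel) \<rightarrow>\<^sub>M Pi\<^sub>M I (\<lambda>_. lborel)"
        unfolding T_def using psubset.prems(1) by (rule measurable_restrict_add_cnj)
      define h where "h = (\<lambda>w x y. g (w(j := y, i := x)))"
      have split: "(\<integral>\<^sup>+ v. G v \<partial>Pi\<^sub>M I (\<lambda>_. lborel)) =
          (\<integral>\<^sup>+ v. \<integral>\<^sup>+ y. \<integral>\<^sup>+ x. G (v(j := y, i := x)) \<partial>lborel \<partial>lborel \<partial>Pi\<^sub>M J (\<lambda>_. lborel))"
        if [measurable]: "G \<in> borel_measurable (Pi\<^sub>M I (\<lambda>_. lborel))" for G :: "('i \<Rightarrow> complex) \<Rightarrow> ennreal"
      proof -
        have "(\<lambda>p. (fst p)(i := snd p)) \<in>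
            Pi\<^sub>M (insert j J) (\<lambda>_. lborel) \<Otimes>\<^sub>M lborel \<rightarrow>\<^sub>M Pi\<^sub>M I (\<lambda>_. lborel)"
          by (rule measurable_fun_upd[where J = "insert j J"]) (use J in auto)
        from measurable_compose[OF this that]
        have [measurable]: "(\<lambda>v. \<integral>\<^sup>+ x. G (v(i := x)) \<partial>lborel) \<in> borel_measurable (Pi\<^sub>M (insert j J) (\<lambda>_. lborel))"
          by (intro lborel.borel_measurable_nn_integral) (simp add: case_prod_beta')
        have "(\<integral>\<^sup>+ v. G v \<partial>Pi\<^sub>M I (\<lambda>_. lborel)) =
            (\<integral>\<^sup>+ v. \<integral>\<^sup>+ x. G (v(i := x)) \<partial>lborel \<partial>Pi\<^sub>M (insert j J) (\<lambda>_. lborel))"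
          unfolding J(1) by (rule product_nn_integral_insert)
            (use J(1-4) ij(1) that in \<open>simp_all flip: J(1)\<close>)
        also have "\<dots> = (\<integral>\<^sup>+ v. \<integral>\<^sup>+ y. \<integral>\<^sup>+ x. G (v(j := y, i := x)) \<partial>lborel \<partial>lborel \<partial>Pi\<^sub>M J (\<lambda>_. lborel))"
          by (rule product_nn_integral_insert) (use J in simp_all)
        finally show ?thesis .
      qed
      have h [measurable]: "(\<lambda>p. h (fst p) (fst (snd p)) (snd (snd p))) \<in>
          borel_measurable (Pi\<^sub>M J (\<lambda>_. lborel) \<Otimes>\<^sub>M (borel \<Otimes>\<^sub>M borel))"
      proof -
        have "(\<lambda>p. (fst p)(j := snd (snd p))) \<in>
            Pi\<^sub>M J (\<lambda>_. lborel) \<Otimes>\<^sub>M (borel \<Otimes>\<^sub>M borel) \<rightarrow>\<^sub>M Pi\<^sub>M (insert j J) (\<lambda>_. lborel)"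
          by (rule measurable_fun_upd[where J = J]) (use J in auto)
        then have "(\<lambda>p. (fst p)(j := snd (snd p), i := fst (snd p))) \<in>
            Pi\<^sub>M J (\<lambda>_. lborel) \<Otimes>\<^sub>M (borel \<Otimes>\<^sub>M borel) \<rightarrow>\<^sub>M Pi\<^sub>M I (\<lambda>_. lborel)"
          by (rule measurable_fun_upd[where J = "insert j J", rotated]) (use J in auto)
        from measurable_compose[OF this psubset.prems(3)] show ?thesis
          by (simp only: h_def)
      qed
      \<comment> \<open>Stated for general \<open>F\<close> and \<open>b\<close> to serve twice:
        with \<open>F = T J\<close> to pull out the constant factor, and with the identity and
        \<open>b = 0\<close> to supply the measurability that the induction hypothesis asks
        for.\<close>
      have meas: "(\<lambda>v. \<integral>\<^sup>+ y. \<integral>\<^sup>+ x. h (F v) (x + b * cnj y) (y + b * cnj x) \<partial>lborel \<partial>lborel)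
          \<in> borel_measurable (Pi\<^sub>M J (\<lambda>_. lborel))"
        if [measurable]: "F \<in> Pi\<^sub>M J (\<lambda>_. lborel) \<rightarrow>\<^sub>M Pi\<^sub>M J (\<lambda>_. lborel)" for F b
      proof -
        have "(\<lambda>q. (F (fst (fst q)), snd q + b * cnj (snd (fst q)), snd (fst q) + b * cnj (snd q)))
            \<in> (Pi\<^sub>M J (\<lambda>_. lborel) \<Otimes>\<^sub>M borel) \<Otimes>\<^sub>M borel \<rightarrow>\<^sub>M
              Pi\<^sub>M J (\<lambda>_. lborel) \<Otimes>\<^sub>M (borel \<Otimes>\<^sub>M borel)"
          by measurable
        from measurable_compose[OF this h] show ?thesis
          by (intro lborel.borel_measurable_nn_integral) (simp add: case_prod_beta')
      qed
      have Tupd: "T I (v(j := y, i := x)) = (T J v)(j := y + a * cnj x, i := x + a * cnj y)" for v x y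
      proof
        fix k
        show "T I (v(j := y, i := x)) k = ((T J v)(j := y + a * cnj x, i := x + a * cnj y)) k"
        proof (cases "k \<in> J")
          case True
          then have "k \<noteq> i" "k \<noteq> j" "\<sigma> k \<noteq> i" "\<sigma> k \<noteq> j" "k \<in> I" using \<sigma>(1)[of k] J by auto
          then show ?thesis using True by (simp add: T_def)
        next
          case False
          then show ?thesis using J ij by (auto simp: T_def)
        qed
      qed
      have cc: "ennreal (c ^ card I) = ennreal (c ^ card J) * ennreal (c\<^sup>2)"
        using c J ij(1) by (simp add: ennreal_mult power2_eq_square mult.commute mult.left_commute)
      have step: "ennreal (c\<^sup>2) * (\<integral>\<^sup>+ y. \<integral>\<^sup>+ x. h (T J v) (x + a * cnj y) (y + a * cnj x) \<partial>lborel \<partial>lborel) =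
          (\<integral>\<^sup>+ y. \<integral>\<^sup>+ x. h (T J v) x y \<partial>lborel \<partial>lborel)"
        if "v \<in> space (Pi\<^sub>M J (\<lambda>_. lborel))" for v
      proof -
        have "T J v \<in> space (Pi\<^sub>M J (\<lambda>_. lborel))"
          using measurable_space[OF TJ that] .
        then have "case_prod (h (T J v)) \<in> borel_measurable (borel \<Otimes>\<^sub>M borel)"
          using measurable_Pair2[OF h] by (simp add: case_prod_beta')
        then show ?thesis
          unfolding c_def using a by (rule nn_integral_add_cnj_pair)
      qed
      have "(\<integral>\<^sup>+ v. g (T I v) \<partial>Pi\<^sub>M I (\<lambda>_. lborel)) =
          (\<integral>\<^sup>+ v. \<integral>\<^sup>+ y. \<integral>\<^sup>+ x. h (T J v) (x + a * cnj y) (y + a * cnj x) \<partial>lborel \<partial>lborel \<partial>Pi\<^sub>M J (\<lambda>_. lborel))"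
        by (subst split) (simp_all add: Tupd h_def)
      then have "ennreal (c\<^sup>2) * (\<integral>\<^sup>+ v. g (T I v) \<partial>Pi\<^sub>M I (\<lambda>_. lborel)) =
          (\<integral>\<^sup>+ v. ennreal (c\<^sup>2) * (\<integral>\<^sup>+ y. \<integral>\<^sup>+ x. h (T J v) (x + a * cnj y) (y + a * cnj x) \<partial>lborel \<partial>lborel) \<partial>Pi\<^sub>M J (\<lambda>_. lborel))"
        by (simp add: nn_integral_cmult meas[OF TJ])
      also have "\<dots> = (\<integral>\<^sup>+ v. \<integral>\<^sup>+ y. \<integral>\<^sup>+ x. h (T J v) x y \<partial>lborel \<partial>lborel \<partial>Pi\<^sub>M J (\<lambda>_. lborel))"
        by (intro nn_integral_cong step)
      finally have "ennreal (c ^ card I) * (\<integral>\<^sup>+ v. g (T I v) \<partial>Pi\<^sub>M I (\<lambda>_. lborel)) =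
          ennreal (c ^ card J) * (\<integral>\<^sup>+ v. \<integral>\<^sup>+ y. \<integral>\<^sup>+ x. h (T J v) x y \<partial>lborel \<partial>lborel \<partial>Pi\<^sub>M J (\<lambda>_. lborel))"
        using cc by (simp only: mult.assoc)
      also have "\<dots> = (\<integral>\<^sup>+ v. \<integral>\<^sup>+ y. \<integral>\<^sup>+ x. h v x y \<partial>lborel \<partial>lborel \<partial>Pi\<^sub>M J (\<lambda>_. lborel))"
        unfolding c_def T_def using J(5) \<sigma> meas[OF measurable_ident, of 0] by (intro psubset.IH) simp_all
      also have "\<dots> = (\<integral>\<^sup>+ v. g v \<partial>Pi\<^sub>M I (\<lambda>_. lborel))"
        by (subst split) (simp_all add: h_def)
      finally show ?thesis by (simp only: c_def T_def)
    qed
  qed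
qed

section \<open>Coefficients of exponential and logarithm\<close>

text \<open>\<open>log_coeffs\<close> and \<open>exp_coeffs\<close> solve the same recursion
  \<open>n x\<^sub>n = - (\<Sum>k=1..n. k f\<^sub>k x\<^bsub>n-k\<^esub>)\<close>, the coefficient form of \<open>x' = - f' x\<close>, for \<open>f\<close> and for \<open>x\<close>.\<close>

fun exp_coeffs :: "(nat \<Rightarrow> complex) \<Rightarrow> nat \<Rightarrow> complex" where
  "exp_coeffs f 0 = 1"
| "exp_coeffs f (Suc n) =
     - f (Suc n) - (\<Sum>k<n. of_nat (Suc k) * f (Suc k) * exp_coeffs f (n - k)) / of_nat (Suc n)"

fun log_coeffs :: "(nat \<Rightarrow> complex) \<Rightarrow> nat \<Rightarrow> complex" where
  "log_coeffs x 0 = 0"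
| "log_coeffs x (Suc n) =
     - x (Suc n) - (\<Sum>k<n. of_nat (Suc k) * log_coeffs x (Suc k) * x (n - k)) / of_nat (Suc n)"

declare exp_coeffs.simps(2) [simp del] log_coeffs.simps(2) [simp del]

text \<open>By induction the two sums agree, and the two recursions are one equation solved for
  different unknowns. Since the term with constant coefficient 1 is split off, neither recursion
  reads its argument at index 0, where a restricted function carries no information.\<close>

lemma exp_coeffs_log_coeffs:
  assumes "\<And>i. i \<in> {1..n} \<Longrightarrow> f i = log_coeffs x i" and "n \<ge> 1"
  shows "exp_coeffs f n = x n"
  using assms
proof (induction n rule: less_induct)
  case (less n)
  then obtain m where m: "n = Suc m" by (cases n) auto
  have "(\<Sum>k<m. of_nat (Suc k) * f (Suc k) * exp_coeffs f (m - k)) =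
      (\<Sum>k<m. of_nat (Suc k) * log_coeffs x (Suc k) * x (m - k))"
    using less m by (intro sum.cong) auto
  then show ?case using less.prems m exp_coeffs.simps(2)[of f m] log_coeffs.simps(2)[of x m]
    by (simp del: of_nat_Suc)
qed

lemma log_coeffs_exp_coeffs:
  assumes "\<And>i. i \<in> {1..n} \<Longrightarrow> x i = exp_coeffs f i" and "n \<ge> 1"
  shows "log_coeffs x n = f n"
  using assms
proof (induction n rule: less_induct)
  case (less n)
  then obtain m where m: "n = Suc m" by (cases n) auto
  have "(\<Sum>k<m. of_nat (Suc k) * f (Suc k) * exp_coeffs f (m - k)) =
      (\<Sum>k<m. of_nat (Suc k) * log_coeffs x (Suc k) * x (m - k))"
  proof (intro sum.cong refl)
    fix k assume "k \<in> {..<m}"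
    then have "Suc k < n" "m - k \<in> {1..n}" using m by auto
    then have "log_coeffs x (Suc k) = f (Suc k)" "x (m - k) = exp_coeffs f (m - k)"
      using less.IH[of "Suc k"] less.prems(1) by auto
    then show "of_nat (Suc k) * f (Suc k) * exp_coeffs f (m - k) =
        of_nat (Suc k) * log_coeffs x (Suc k) * x (m - k)" by simp
  qed
  then show ?case using less.prems m exp_coeffs.simps(2)[of f m] log_coeffs.simps(2)[of x m]
    by (simp del: of_nat_Suc)
qed

text \<open>Comparison of the coefficients of \<open>z^n\<close> in \<open>X' = - F' X\<close>. The
  summand \<open>k = n\<close> is isolated, where the factor of \<open>X\<close> is its constant
  term 1.\<close>

lemma fps_deriv_eq_recursion:
  fixes X F :: "complex fps"
  assumes D: "fps_deriv X = - (fps_deriv F * X)" and X0: "fps_nth X 0 = 1"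
  shows "fps_nth X (Suc n) = - fps_nth F (Suc n) -
    (\<Sum>k<n. of_nat (Suc k) * fps_nth F (Suc k) * fps_nth X (n - k)) / of_nat (Suc n)"
proof -
  have "of_nat (Suc n) * fps_nth X (Suc n) = fps_nth (fps_deriv X) n" by simp
  also have "\<dots> = - (\<Sum>k=0..n. of_nat (Suc k) * fps_nth F (Suc k) * fps_nth X (n - k))"
    by (simp add: D fps_mult_nth)
  also have "{0..n} = insert n {..<n}" by auto
  finally have "of_nat (Suc n) * fps_nth X (Suc n) = - (of_nat (Suc n) * fps_nth F (Suc n)) -
    (\<Sum>k<n. of_nat (Suc k) * fps_nth F (Suc k) * fps_nth X (n - k))"
    using X0 by simp
  moreover have "(of_nat (Suc n) :: complex) \<noteq> 0" by (rule of_nat_neq_0)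
  ultimately show ?thesis by (simp add: field_simps del: of_nat_Suc)
qed

text \<open>The exponential of a negated polynomial \<open>P\<close> solves
  \<open>E' = - P' E\<close> by the chain rule, so the coefficient recursion applies to it.\<close>

lemma f_to_x_eq: "f_to_x N f = (\<lambda>n\<in>{1..N}. exp_coeffs f n)"
proof -
  \<comment> \<open>Padding by zero outside \<open>{1..N}\<close> matches the finite sum in the
    exponent. Up to index \<open>N\<close> the recursion reads \<open>f\<close> only inside this
    range.\<close>
  define P where "P = Abs_fps (\<lambda>k. if k \<in> {1..N} then f k else 0)"
  define E where "E = fps_exp 1 oo (- P)"
  have P0: "fps_nth P 0 = 0" by (simp add: P_def)
  have "(\<lambda>z. \<Sum>k=1..N. f k * z ^ k) has_fps_expansion (\<Sum>k=1..N. fps_const (f k) * fps_X ^ k)"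
    by (intro fps_expansion_intros)
  also have "(\<Sum>k=1..N. fps_const (f k) * fps_X ^ k) = P"
    by (rule fps_ext) (auto simp: P_def fps_sum_nth fps_X_power_iff if_distrib cong: if_cong)
  finally have "(exp \<circ> (\<lambda>z. - (\<Sum>k=1..N. f k * z ^ k))) has_fps_expansion E"
    unfolding E_def using P0
    by (intro has_fps_expansion_compose fps_expansion_intros) (auto intro!: fps_expansion_intros)
  then have E: "fps_expansion (\<lambda>z. exp (- (\<Sum>k=1..N. f k * z ^ k))) 0 = E"
    by (intro fps_expansion_eqI) (simp add: o_def)
  have "fps_deriv E = E * fps_deriv (- P)"
    unfolding E_def using P0 by (subst fps_compose_deriv) auto
  then have D: "fps_deriv E = - (fps_deriv P * E)" by simp
  have E0: "fps_nth E 0 = 1" by (simp add: E_def)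
  have "fps_nth E n = exp_coeffs f n" if "n \<le> N" for n
    using that
  proof (induction n rule: less_induct)
    case (less n)
    show ?case
    proof (cases n)
      case (Suc m)
      have *: "(\<Sum>k<m. of_nat (Suc k) * fps_nth P (Suc k) * fps_nth E (m - k)) =
          (\<Sum>k<m. of_nat (Suc k) * f (Suc k) * exp_coeffs f (m - k))"
        using less Suc by (intro sum.cong) (auto simp: P_def)
      show ?thesis
        using less.prems unfolding Suc fps_deriv_eq_recursion[OF D E0] exp_coeffs.simps(2) *
        by (simp add: P_def del: of_nat_Suc)
    qed (simp add: E0)
  qed
  then show ?thesis unfolding f_to_x_def E by (intro restrict_ext) auto
qed

text \<open>Near 0 the logarithmic derivative gives \<open>f_+' x = - x'\<close>. Read as an
  identity of power series, this is the recursion that determines the coefficients of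
  \<open>f_+\<close> from those of \<open>x\<close>.\<close>

lemma alpha_to_f_eq: "alpha_to_f N \<alpha> = (\<lambda>n\<in>{1..N}. log_coeffs (alpha_to_x N \<alpha>) n)"
proof -
  define p where "p = x_poly N \<alpha>"
  have p0: "coeff p 0 = 1" by (simp add: p_def coeff_x_poly_0)
  then have "poly p 0 = 1" by (simp add: poly_0_coeff_0)
  have X: "poly p has_fps_expansion fps_of_poly p"
    by (simp add: has_fps_expansion_def)
  have "poly p analytic_on {0}"
    using X by (rule has_fps_expansion_imp_analytic_0)
  then have "(\<lambda>z. - Ln (poly p z)) analytic_on {0}"
    using \<open>poly p 0 = 1\<close> by (intro analytic_intros) auto
  then have an: "f_plus p analytic_on {0}"
    by (simp add: f_plus_def [abs_def])
  define F where "F = fps_expansion (f_plus p) 0"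
  have F: "f_plus p has_fps_expansion F"
    unfolding F_def using an by (rule analytic_at_imp_has_fps_expansion_0)
  have l: "(\<lambda>z. deriv (f_plus p) z * poly p z) has_fps_expansion fps_deriv F * fps_of_poly p"
    by (intro fps_expansion_intros F X)
  have r: "(\<lambda>z. - poly (pderiv p) z) has_fps_expansion - fps_of_poly (pderiv p)"
    by (intro fps_expansion_intros) (simp add: has_fps_expansion_def)
  \<comment> \<open>Since \<open>p\<close> takes the value 1 at 0, it avoids the branch cut of
    \<open>Ln\<close> on a neighbourhood of 0, where the principal branch can be
    differentiated.\<close>
  have "open (poly p -` (- \<real>\<^sub>\<le>\<^sub>0))"
    by (rule open_vimage) (auto intro!: continuous_intros closed_nonpos_Reals_complex)
  then have "eventually (\<lambda>z. z \<in> poly p -` (- \<real>\<^sub>\<le>\<^sub>0)) (nhds 0)"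
    using \<open>poly p 0 = 1\<close> by (intro eventually_nhds_in_open) auto
  then have ev: "eventually (\<lambda>z. deriv (f_plus p) z * poly p z = - poly (pderiv p) z) (nhds 0)"
  proof eventually_elim
    case (elim z)
    then have "(f_plus p has_field_derivative - (poly (pderiv p) z / poly p z)) (at z)"
      unfolding f_plus_def [abs_def] by (auto intro!: derivative_eq_intros poly_DERIV simp: field_simps)
    moreover have "poly p z \<noteq> 0" using elim by auto
    ultimately show ?case by (simp add: DERIV_imp_deriv)
  qed
  have "(\<lambda>z. - poly (pderiv p) z) has_fps_expansion fps_deriv F * fps_of_poly p"
    using has_fps_expansion_cong[OF ev refl] l by blast
  then have "fps_deriv F * fps_of_poly p = - fps_of_poly (pderiv p)"
    using r by (rule fps_expansion_unique_complex)
  then have D: "fps_deriv (fps_of_poly p) = - (fps_deriv F * fps_of_poly p)"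
    by (simp add: fps_of_poly_pderiv)
  have X0: "fps_nth (fps_of_poly p) 0 = 1" by (simp add: p0)
  define X where "X = alpha_to_x N \<alpha>"
  have X: "coeff p i = X i" if "1 \<le> i" "i \<le> N" for i
    using that by (simp add: X_def alpha_to_x_def p_def)
  have "fps_nth F n = log_coeffs X n" if "n \<le> N" "n \<ge> 1" for n
    using that
  proof (induction n rule: less_induct)
    case (less n)
    then obtain m where m: "n = Suc m" by (cases n) auto
    have "(\<Sum>k<m. of_nat (Suc k) * fps_nth F (Suc k) * coeff p (m - k)) =
        (\<Sum>k<m. of_nat (Suc k) * log_coeffs X (Suc k) * X (m - k))"
      using less m X by (intro sum.cong) auto
    \<comment> \<open>The recursion yields \<open>X n\<close> in terms of the coefficients of
      \<open>F\<close>. Being symmetric in \<open>X n\<close> and \<open>fps_nth F n\<close>, it can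
      be solved for the latter.\<close>
    then have c: "X n = - fps_nth F n - (\<Sum>k<m. of_nat (Suc k) * log_coeffs X (Suc k) * X (m - k)) / of_nat (Suc m)"
      using fps_deriv_eq_recursion[OF D X0, of m] m X[of n] less.prems by (simp del: of_nat_Suc)
    show ?case
      unfolding m log_coeffs.simps(2)[of X m] c[unfolded m] by simp
  qed
  then show ?thesis
    unfolding alpha_to_f_def F_def p_def X_def by (intro restrict_ext) auto
qed

text \<open>This is the triangularity of the map: changing a later coordinate of \<open>f\<close>
  leaves the earlier coefficients of \<open>x\<close> alone.\<close>

lemma exp_coeffs_cong:
  assumes "\<And>i. i \<in> {1..n} \<Longrightarrow> f i = g i"
  shows "exp_coeffs f n = exp_coeffs g n"
  using assms
proof (induction n rule: less_induct)
  case (less n)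
  show ?case
  proof (cases n)
    case (Suc m)
    have "(\<Sum>k<m. of_nat (Suc k) * f (Suc k) * exp_coeffs f (m - k)) =
        (\<Sum>k<m. of_nat (Suc k) * g (Suc k) * exp_coeffs g (m - k))"
    proof (intro sum.cong refl)
      fix k assume "k \<in> {..<m}"
      then have "exp_coeffs f (m - k) = exp_coeffs g (m - k)" "f (Suc k) = g (Suc k)"
        using less Suc by auto
      then show "of_nat (Suc k) * f (Suc k) * exp_coeffs f (m - k) =
          of_nat (Suc k) * g (Suc k) * exp_coeffs g (m - k)" by simp
    qed
    then show ?thesis using less.prems by (simp add: Suc exp_coeffs.simps(2)[of _ m])
  qed simp
qed

section \<open>Polynomial dependence on the coordinates\<close>

lemma coord_polynomial_uminus:
  "coord_polynomial I p \<Longrightarrow> coord_polynomial I (\<lambda>v. - p v)"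
  using coord_polynomial.mult[OF coord_polynomial.const[of I "-1"]] by fastforce

lemma coord_polynomial_diff:
  "coord_polynomial I p \<Longrightarrow> coord_polynomial I q \<Longrightarrow> coord_polynomial I (\<lambda>v. p v - q v)"
  using coord_polynomial.add[OF _ coord_polynomial_uminus] by fastforce

lemma coord_polynomial_divide:
  "coord_polynomial I p \<Longrightarrow> coord_polynomial I (\<lambda>v. p v / c)"
  using coord_polynomial.mult[OF _ coord_polynomial.const[of I "inverse c"]]
  by (simp add: divide_inverse)

lemma coord_polynomial_sum:
  assumes "\<And>k. k \<in> A \<Longrightarrow> coord_polynomial I (p k)"
  shows "coord_polynomial I (\<lambda>v. \<Sum>k\<in>A. p k v)"
  using assms
  by (induction A rule: infinite_finite_induct) (auto intro: coord_polynomial.intros)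

lemma coord_polynomial_exp_coeffs:
  "n \<le> N \<Longrightarrow> coord_polynomial {1..N} (\<lambda>f. exp_coeffs f n)"
proof (induction n rule: less_induct)
  case (less n)
  show ?case
  proof (cases n)
    case (Suc m)
    show ?thesis
      unfolding Suc exp_coeffs.simps(2)[of _ m]
      using less Suc
      by (intro coord_polynomial_diff coord_polynomial_uminus coord_polynomial_divide
          coord_polynomial_sum coord_polynomial.mult coord_polynomial.const coord_polynomial.coord less.IH) auto
  qed (simp add: coord_polynomial.const)
qed

text \<open>Provides the measurability of the inverse of \<open>f_to_x N\<close>.\<close>

lemma coord_polynomial_log_coeffs:
  "n \<le> N \<Longrightarrow> coord_polynomial {1..N} (\<lambda>x. log_coeffs x n)"
proof (induction n rule: less_induct)
  case (less n)
  show ?case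
  proof (cases n)
    case (Suc m)
    show ?thesis
      unfolding Suc log_coeffs.simps(2)[of _ m]
      using less Suc
      by (intro coord_polynomial_diff coord_polynomial_uminus coord_polynomial_divide
          coord_polynomial_sum coord_polynomial.mult coord_polynomial.const coord_polynomial.coord less.IH) auto
  qed (simp add: coord_polynomial.const)
qed

section \<open>The measure in the polynomial coefficients\<close>

lemma alpha_to_x_0: "alpha_to_x 0 \<alpha> = (\<lambda>_. undefined)"
  by (simp add: alpha_to_x_def fun_eq_iff)

text \<open>The new left factor adds \<open>a z^(N+1)\<close> times the star of \<delta> to
  \<gamma>, and the same multiple of the star of \<gamma> to \<delta>. Adding the two rows gives a
  recursion that involves only the sum of \<gamma> and \<delta>.\<close>

lemma x_poly_Suc:
  "x_poly (Suc N) \<alpha> = x_poly N \<alpha> + smult (\<alpha> (Suc N)) (star_shift (Suc N) (x_poly N \<alpha>))"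
proof (rule poly_eqI_nonzero)
  fix z :: complex assume z: "z \<noteq> 0"
  let ?m = "\<lambda>N. matrix22 (poly_star (delta2 N \<alpha>) z) (poly_star (gamma2 N \<alpha>) z)
    (poly (gamma2 N \<alpha>) z) (poly (delta2 N \<alpha>) z)"
  have "?m (Suc N) = elem_factor (\<alpha> (Suc N)) (Suc N) z ** ?m N"
    using gamma_delta_correct[of N \<alpha>] gamma_delta_correct[of "Suc N" \<alpha>] z
    by (simp add: is_gamma_delta_def)
  then have "poly (gamma2 (Suc N) \<alpha>) z =
      \<alpha> (Suc N) * z ^ Suc N * poly_star (delta2 N \<alpha>) z + poly (gamma2 N \<alpha>) z"
    and "poly (delta2 (Suc N) \<alpha>) z =
      \<alpha> (Suc N) * z ^ Suc N * poly_star (gamma2 N \<alpha>) z + poly (delta2 N \<alpha>) z"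
    by (simp_all add: elem_factor_def matrix22_mult matrix22_eq_iff)
  moreover have "poly_star (x_poly N \<alpha>) z = poly_star (gamma2 N \<alpha>) z + poly_star (delta2 N \<alpha>) z"
    by (simp add: poly_star_def x_poly_def)
  moreover have "poly (star_shift (Suc N) (x_poly N \<alpha>)) z = z ^ Suc N * poly_star (x_poly N \<alpha>) z"
    using degree_x_poly[of N \<alpha>] z by (intro poly_star_shift) auto
  ultimately show "poly (x_poly (Suc N) \<alpha>) z =
      poly (x_poly N \<alpha> + smult (\<alpha> (Suc N)) (star_shift (Suc N) (x_poly N \<alpha>))) z"
    by (simp add: x_poly_def[of "Suc N"] algebra_simps) (simp add: x_poly_def)
qed

text \<open>One factor of the matrix product sends \<open>x\<close> to \<open>x + a z\<^sup>N\<^sup>+\<^sup>1 x\<^sup>*\<close>. Its new top coefficient is \<open>a\<close>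
  itself, because \<open>x\<close> has constant term 1.\<close>

definition szego_step :: "nat \<Rightarrow> complex \<Rightarrow> (nat \<Rightarrow> complex) \<Rightarrow> nat \<Rightarrow> complex" where
  "szego_step N a x = (\<lambda>k\<in>{1..N}. x k + a * cnj (x (Suc N - k)))"

text \<open>Solution of \<open>y k = x k + a * cnj (x (Suc N - k))\<close> for \<open>x\<close>:
  eliminating with the conjugate of the equation at \<open>Suc N - k\<close> leaves
  \<open>(1 - |a|^2) * x k\<close> on one side.\<close>

definition szego_unstep :: "nat \<Rightarrow> complex \<Rightarrow> (nat \<Rightarrow> complex) \<Rightarrow> nat \<Rightarrow> complex" where
  "szego_unstep N a y =
     (\<lambda>k\<in>{1..N}. (y k - a * cnj (y (Suc N - k))) / of_real (1 - (cmod a)\<^sup>2))"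

lemma alpha_to_x_Suc:
  "alpha_to_x (Suc N) \<alpha> = (szego_step N (\<alpha> (Suc N)) (alpha_to_x N \<alpha>))(Suc N := \<alpha> (Suc N))"
proof
  fix k
  \<comment> \<open>At index \<open>Suc N\<close> only the shifted star contributes, namely \<alpha>
    at \<open>Suc N\<close> times the conjugate of the constant term 1.\<close>
  have "coeff (x_poly N \<alpha>) (Suc N) = 0"
    using degree_x_poly[of N \<alpha>] by (intro coeff_eq_0) auto
  then show "alpha_to_x (Suc N) \<alpha> k =
      ((szego_step N (\<alpha> (Suc N)) (alpha_to_x N \<alpha>))(Suc N := \<alpha> (Suc N))) k"
    using coeff_x_poly_0[of N \<alpha>]
    by (auto simp: alpha_to_x_def szego_step_def x_poly_Suc coeff_star_shift)
qed

lemma alpha_to_x_cong: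
  assumes "\<And>i. i \<in> {1..N} \<Longrightarrow> \<alpha> i = \<beta> i"
  shows "alpha_to_x N \<alpha> = alpha_to_x N \<beta>"
  using assms by (induction N) (simp_all add: alpha_to_x_0 alpha_to_x_Suc)

lemma alpha_to_x_in_space: "alpha_to_x N \<alpha> \<in> complex_space N"
  by (auto simp: alpha_to_x_def)

lemma szego_unstep_step:
  assumes a: "cmod a < 1" and x: "x \<in> complex_space N"
  shows "szego_unstep N a (szego_step N a x) = x"
proof
  fix k
  have "(cmod a)\<^sup>2 \<noteq> 1" using a by (simp add: power2_eq_1_iff) (use norm_ge_zero[of a] in linarith)
  then have r: "of_real (1 - (cmod a)\<^sup>2) \<noteq> (0 :: complex)" unfolding of_real_eq_0_iff by simp
  have aa: "of_real (1 - (cmod a)\<^sup>2) = 1 - a * cnj a" using complex_norm_square[of a] by simp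
  show "szego_unstep N a (szego_step N a x) k = x k"
  proof (cases "k \<in> {1..N}")
    case True
    then have "Suc N - k \<in> {1..N}" "Suc N - (Suc N - k) = k" by auto
    then show ?thesis
      using True r unfolding aa szego_unstep_def szego_step_def
      by (simp add: field_simps)
  next
    case False
    then show ?thesis using x by (auto simp: szego_unstep_def PiE_def extensional_def)
  qed
qed

lemma szego_step_unstep:
  assumes a: "cmod a < 1"
  shows "szego_step N a (szego_unstep N a y) = restrict y {1..N}"
proof
  fix k
  have "(cmod a)\<^sup>2 \<noteq> 1" using a by (simp add: power2_eq_1_iff) (use norm_ge_zero[of a] in linarith)
  then have r: "of_real (1 - (cmod a)\<^sup>2) \<noteq> (0 :: complex)" unfolding of_real_eq_0_iff by simp
  have aa: "of_real (1 - (cmod a)\<^sup>2) = 1 - a * cnj a" using complex_norm_square[of a] by simp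
  show "szego_step N a (szego_unstep N a y) k = restrict y {1..N} k"
  proof (cases "k \<in> {1..N}")
    case True
    then have "Suc N - k \<in> {1..N}" "Suc N - (Suc N - k) = k" by auto
    then show ?thesis
      using True r unfolding aa szego_unstep_def szego_step_def
      by (simp add: divide_simps) (simp add: algebra_simps)
  qed (auto simp: szego_step_def)
qed

section \<open>Measurability, sigma-finiteness and iterated integrals\<close>

lemma sets_alpha_measure [measurable_cong]: "sets (alpha_measure N) = sets (lebesgue_CN N)"
  unfolding alpha_measure_def lebesgue_CN_def by (intro sets_PiM_cong) auto

lemma space_lebesgue_CN: "space (lebesgue_CN N) = complex_space N"
  by (simp add: lebesgue_CN_def space_PiM)

text \<open>Each weight is at most 1 on a disc of finite area, so each factor is even finite. All
  indices are covered, also \<open>n = 0\<close>, where the truncated exponent is 0.\<close>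

lemma product_sigma_finite_alpha:
  "product_sigma_finite (\<lambda>n::nat. density lborel
     (\<lambda>a. ennreal ((1 - (cmod a)\<^sup>2) ^ (n - 1)) * indicator (ball 0 1) a))"
proof (rule product_sigma_finite.intro)
  fix n :: nat
  let ?w = "\<lambda>a::complex. ennreal ((1 - (cmod a)\<^sup>2) ^ (n - 1)) * indicator (ball 0 1) a"
  have "?w a \<le> indicator (ball 0 1) a" for a :: complex
  proof (cases "cmod a < 1")
    case True
    then have "(1 - (cmod a)\<^sup>2) ^ (n - 1) \<le> 1"
      by (intro power_le_one) (auto simp: abs_square_le_1)
    then show ?thesis by (simp add: indicator_def)
  qed simp
  then have "(\<integral>\<^sup>+ a. ?w a \<partial>lborel) \<le> (\<integral>\<^sup>+ a. indicator (ball 0 1) (a :: complex) \<partial>lborel)"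
    by (intro nn_integral_mono)
  also have "\<dots> < \<infinity>"
    using emeasure_lborel_ball_finite[of "0 :: complex" 1] by (simp add: less_top)
  finally have fin: "(\<integral>\<^sup>+ a. ?w a \<partial>lborel) < \<infinity>" .
  have "ball (0 :: complex) 1 \<in> sets borel" by simp
  then have "?w \<in> borel_measurable lborel" by measurable
  with fin have "finite_measure (density lborel ?w)"
    by (intro finite_measureI) (simp add: emeasure_density less_top)
  then show "sigma_finite_measure (density lborel ?w)"
    by (rule finite_measure.axioms)
qed

text \<open>Measurability is joint in \<open>a\<close> and \<open>x\<close>, because
  \<open>a\<close> is itself a coordinate that is integrated over or read off from the
  point.\<close>

lemma measurable_szego_step [measurable]:
  "(\<lambda>p. szego_step N (fst p) (snd p)) \<in> borel \<Otimes>\<^sub>M lebesgue_CN N \<rightarrow>\<^sub>M lebesgue_CN N"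
  "(\<lambda>p. szego_unstep N (fst p) (snd p)) \<in> borel \<Otimes>\<^sub>M lebesgue_CN N \<rightarrow>\<^sub>M lebesgue_CN N"
proof -
  have *: "(\<lambda>p. snd p k) \<in> borel_measurable (borel \<Otimes>\<^sub>M lebesgue_CN N)" if "k \<in> {1..N}" for k
    using measurable_compose[OF measurable_snd measurable_component_singleton[OF that], of borel "\<lambda>_. lborel"]
    by (simp add: lebesgue_CN_def)
  show "(\<lambda>p. szego_step N (fst p) (snd p)) \<in> borel \<Otimes>\<^sub>M lebesgue_CN N \<rightarrow>\<^sub>M lebesgue_CN N"
    unfolding szego_step_def lebesgue_CN_def
  proof (rule measurable_restrict)
    fix k assume "k \<in> {1..N}"
    then have [measurable]: "(\<lambda>p. snd p k) \<in> borel_measurable (borel \<Otimes>\<^sub>M lebesgue_CN N)"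
      "(\<lambda>p. snd p (Suc N - k)) \<in> borel_measurable (borel \<Otimes>\<^sub>M lebesgue_CN N)"
      by (intro *; auto)+
    have "(\<lambda>p. snd p k + fst p * cnj (snd p (Suc N - k))) \<in> borel_measurable (borel \<Otimes>\<^sub>M lebesgue_CN N)"
      by measurable
    then show "(\<lambda>p. snd p k + fst p * cnj (snd p (Suc N - k))) \<in> borel \<Otimes>\<^sub>M Pi\<^sub>M {1..N} (\<lambda>_. lborel) \<rightarrow>\<^sub>M lborel"
      by (simp add: lebesgue_CN_def)
  qed
  show "(\<lambda>p. szego_unstep N (fst p) (snd p)) \<in> borel \<Otimes>\<^sub>M lebesgue_CN N \<rightarrow>\<^sub>M lebesgue_CN N"
    unfolding szego_unstep_def lebesgue_CN_def
  proof (rule measurable_restrict)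
    fix k assume "k \<in> {1..N}"
    then have [measurable]: "(\<lambda>p. snd p k) \<in> borel_measurable (borel \<Otimes>\<^sub>M lebesgue_CN N)"
      "(\<lambda>p. snd p (Suc N - k)) \<in> borel_measurable (borel \<Otimes>\<^sub>M lebesgue_CN N)"
      by (intro *; auto)+
    have "(\<lambda>p. (snd p k - fst p * cnj (snd p (Suc N - k))) / of_real (1 - (cmod (fst p))\<^sup>2))
        \<in> borel_measurable (borel \<Otimes>\<^sub>M lebesgue_CN N)"
      by measurable
    then show "(\<lambda>p. (snd p k - fst p * cnj (snd p (Suc N - k))) / of_real (1 - (cmod (fst p))\<^sup>2))
        \<in> borel \<Otimes>\<^sub>M Pi\<^sub>M {1..N} (\<lambda>_. lborel) \<rightarrow>\<^sub>M lborel"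
      by (simp add: lebesgue_CN_def)
  qed
qed

lemma insert_Suc_atLeast1AtMost: "{1..Suc N} = insert (Suc N) {1..N}"
  by auto

lemma measurable_upd_lebesgue_CN:
  assumes "f \<in> M \<rightarrow>\<^sub>M lebesgue_CN N" and "h \<in> borel_measurable M"
  shows "(\<lambda>p. (f p)(Suc N := h p)) \<in> M \<rightarrow>\<^sub>M lebesgue_CN (Suc N)"
  using assms unfolding lebesgue_CN_def insert_Suc_atLeast1AtMost
  by (intro measurable_fun_upd[where J = "{1..N}"]) auto

lemma measurable_coord_lebesgue_CN [measurable]:
  "k \<in> {1..N} \<Longrightarrow> (\<lambda>v. v k) \<in> borel_measurable (lebesgue_CN N)"
  using measurable_component_singleton[of k "{1..N}" "\<lambda>_. lborel :: complex measure"]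
  by (simp add: lebesgue_CN_def)

lemma measurable_restrict_lebesgue_CN:
  "(\<lambda>v. restrict v {1..N}) \<in> lebesgue_CN (Suc N) \<rightarrow>\<^sub>M lebesgue_CN N"
  unfolding lebesgue_CN_def by (intro measurable_restrict_subset) auto

lemma measurable_alpha_to_x [measurable]: "alpha_to_x N \<in> lebesgue_CN N \<rightarrow>\<^sub>M lebesgue_CN N"
proof (induction N)
  case 0
  show ?case
    by (simp add: alpha_to_x_0 [abs_def]) (simp add: lebesgue_CN_def space_PiM)
next
  case (Suc N)
  \<comment> \<open>The first \<open>N\<close> parameters determine \<open>alpha_to_x N\<close>, so
    it factors through the restriction from \<open>N + 1\<close> coordinates.\<close>
  have eq: "alpha_to_x N (restrict v {1..N}) = alpha_to_x N v" for v
    by (rule alpha_to_x_cong) auto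
  have [measurable]: "alpha_to_x N \<in> lebesgue_CN (Suc N) \<rightarrow>\<^sub>M lebesgue_CN N"
    using measurable_compose[OF measurable_restrict_lebesgue_CN Suc.IH] by (simp only: eq)
  have [measurable]: "(\<lambda>v. v (Suc N)) \<in> borel_measurable (lebesgue_CN (Suc N))"
    by (rule measurable_coord_lebesgue_CN) auto
  have "(\<lambda>v. (v (Suc N), alpha_to_x N v)) \<in> lebesgue_CN (Suc N) \<rightarrow>\<^sub>M borel \<Otimes>\<^sub>M lebesgue_CN N"
    by measurable
  from measurable_compose[OF this measurable_szego_step(1)]
  have "(\<lambda>v. szego_step N (v (Suc N)) (alpha_to_x N v)) \<in> lebesgue_CN (Suc N) \<rightarrow>\<^sub>M lebesgue_CN N"
    by simp
  then show ?case
    unfolding alpha_to_x_Suc [abs_def] by (rule measurable_upd_lebesgue_CN) measurable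
qed

text \<open>Both orders are needed: the last coordinate is held fixed outside when it is the
  parameter of a Szego step, and integrated inside when it is the one coordinate that a triangular
  map moves.\<close>

lemma nn_integral_lebesgue_CN_Suc:
  assumes "g \<in> borel_measurable (lebesgue_CN (Suc N))"
  shows "(\<integral>\<^sup>+ v. g v \<partial>lebesgue_CN (Suc N)) =
      (\<integral>\<^sup>+ a. \<integral>\<^sup>+ v. g (v(Suc N := a)) \<partial>lebesgue_CN N \<partial>lborel)"
    and "(\<integral>\<^sup>+ v. g v \<partial>lebesgue_CN (Suc N)) =
      (\<integral>\<^sup>+ v. \<integral>\<^sup>+ a. g (v(Suc N := a)) \<partial>lborel \<partial>lebesgue_CN N)"
proof -
  interpret product_sigma_finite "\<lambda>_. lborel :: complex measure"
    by (rule product_sigma_finite_lborel)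
  show "(\<integral>\<^sup>+ v. g v \<partial>lebesgue_CN (Suc N)) =
      (\<integral>\<^sup>+ a. \<integral>\<^sup>+ v. g (v(Suc N := a)) \<partial>lebesgue_CN N \<partial>lborel)"
    using assms unfolding lebesgue_CN_def insert_Suc_atLeast1AtMost
    by (intro product_nn_integral_insert_rev) auto
  show "(\<integral>\<^sup>+ v. g v \<partial>lebesgue_CN (Suc N)) =
      (\<integral>\<^sup>+ v. \<integral>\<^sup>+ a. g (v(Suc N := a)) \<partial>lborel \<partial>lebesgue_CN N)"
    using assms unfolding lebesgue_CN_def insert_Suc_atLeast1AtMost
    by (intro product_nn_integral_insert) auto
qed

lemma sigma_finite_lebesgue_CN: "sigma_finite_measure (lebesgue_CN N)"
proof -
  interpret product_sigma_finite "\<lambda>_. lborel :: complex measure"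
    by (rule product_sigma_finite_lborel)
  show ?thesis unfolding lebesgue_CN_def by (rule sigma_finite) simp
qed

text \<open>The top coefficient of \<open>w\<close> is the last parameter itself. Once it is known,
  the last step can be undone, and the remaining coefficients must come from the first
  \<open>N\<close> parameters.\<close>

lemma alpha_to_x_image_Suc:
  "alpha_to_x (Suc N) ` polydisc (Suc N) =
    {w \<in> complex_space (Suc N). cmod (w (Suc N)) < 1 \<and>
       szego_unstep N (w (Suc N)) (restrict w {1..N}) \<in> alpha_to_x N ` polydisc N}"
proof (intro equalityI subsetI)
  fix w assume "w \<in> alpha_to_x (Suc N) ` polydisc (Suc N)"
  then obtain \<alpha> where \<alpha>: "\<alpha> \<in> polydisc (Suc N)" "w = alpha_to_x (Suc N) \<alpha>" by blast
  define \<beta> where "\<beta> = restrict \<alpha> {1..N}"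
  have \<beta>: "\<beta> \<in> polydisc N" using \<alpha>(1) by (auto simp: \<beta>_def PiE_def Pi_def)
  have a: "cmod (\<alpha> (Suc N)) < 1" using \<alpha>(1) by (auto simp: PiE_def Pi_def)
  have eq: "alpha_to_x N \<alpha> = alpha_to_x N \<beta>" by (rule alpha_to_x_cong) (simp add: \<beta>_def)
  have w: "w = (szego_step N (\<alpha> (Suc N)) (alpha_to_x N \<beta>))(Suc N := \<alpha> (Suc N))"
    by (simp add: \<alpha>(2) alpha_to_x_Suc eq)
  have "restrict w {1..N} = szego_step N (\<alpha> (Suc N)) (alpha_to_x N \<beta>)"
    by (auto simp: w szego_step_def fun_eq_iff)
  then have "szego_unstep N (w (Suc N)) (restrict w {1..N}) = alpha_to_x N \<beta>"
    using szego_unstep_step[OF a alpha_to_x_in_space] by (simp add: w)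
  moreover have "w \<in> complex_space (Suc N)" unfolding \<alpha>(2) by (rule alpha_to_x_in_space)
  ultimately show "w \<in> {w \<in> complex_space (Suc N). cmod (w (Suc N)) < 1 \<and>
       szego_unstep N (w (Suc N)) (restrict w {1..N}) \<in> alpha_to_x N ` polydisc N}"
    using a \<beta> by (simp add: w)
next
  fix w assume "w \<in> {w \<in> complex_space (Suc N). cmod (w (Suc N)) < 1 \<and>
       szego_unstep N (w (Suc N)) (restrict w {1..N}) \<in> alpha_to_x N ` polydisc N}"
  then obtain \<beta> where w: "w \<in> complex_space (Suc N)" "cmod (w (Suc N)) < 1"
      and \<beta>: "\<beta> \<in> polydisc N" "szego_unstep N (w (Suc N)) (restrict w {1..N}) = alpha_to_x N \<beta>"
    by auto
  define \<alpha> where "\<alpha> = \<beta>(Suc N := w (Suc N))"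
  have "alpha_to_x N \<alpha> = alpha_to_x N \<beta>" by (rule alpha_to_x_cong) (simp add: \<alpha>_def)
  then have "alpha_to_x (Suc N) \<alpha> = (restrict w {1..N})(Suc N := w (Suc N))"
    using szego_step_unstep[OF w(2), of N "restrict w {1..N}"] \<beta>(2)
    by (simp add: alpha_to_x_Suc \<alpha>_def)
  also have "\<dots> = w" using w(1) by (auto simp: fun_eq_iff PiE_def extensional_def restrict_def)
  finally have "alpha_to_x (Suc N) \<alpha> = w" .
  moreover have "\<alpha> \<in> polydisc (Suc N)"
    using \<beta>(1) w(2) by (auto simp: \<alpha>_def PiE_def Pi_def extensional_def)
  ultimately show "w \<in> alpha_to_x (Suc N) ` polydisc (Suc N)" by blast
qed

lemma szego_step_mem_image_iff:
  assumes "x \<in> complex_space N"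
  shows "(szego_step N a x)(Suc N := a) \<in> alpha_to_x (Suc N) ` polydisc (Suc N) \<longleftrightarrow>
    cmod a < 1 \<and> x \<in> alpha_to_x N ` polydisc N"
proof -
  have "restrict ((szego_step N a x)(Suc N := a)) {1..N} = szego_step N a x"
    by (auto simp: szego_step_def fun_eq_iff)
  moreover have "(szego_step N a x)(Suc N := a) \<in> complex_space (Suc N)"
    by (auto simp: szego_step_def)
  ultimately show ?thesis
    unfolding alpha_to_x_image_Suc using szego_unstep_step[OF _ assms] by auto
qed

text \<open>Measurable maps need not send measurable sets to measurable sets. Here the recursive
  description exhibits the image through preimages under measurable maps.\<close>

lemma sets_alpha_to_x_image [measurable]: "alpha_to_x N ` polydisc N \<in> sets (lebesgue_CN N)"
proof (induction N)
  case 0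
  show ?case
    by (simp add: alpha_to_x_0 [abs_def]) (simp add: lebesgue_CN_def PiM_empty)
next
  case (Suc N)
  note [measurable] = Suc.IH measurable_restrict_lebesgue_CN
  have [measurable]: "(\<lambda>v. v (Suc N)) \<in> borel_measurable (lebesgue_CN (Suc N))"
    by (rule measurable_coord_lebesgue_CN) auto
  have "(\<lambda>w. (w (Suc N), restrict w {1..N})) \<in> lebesgue_CN (Suc N) \<rightarrow>\<^sub>M borel \<Otimes>\<^sub>M lebesgue_CN N"
    by measurable
  from measurable_compose[OF this measurable_szego_step(2)]
  have [measurable]: "(\<lambda>w. szego_unstep N (w (Suc N)) (restrict w {1..N})) \<in> lebesgue_CN (Suc N) \<rightarrow>\<^sub>M lebesgue_CN N"
    by simp
  show ?case
    unfolding alpha_to_x_image_Suc space_lebesgue_CN[symmetric] by measurable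
qed

text \<open>With the last parameter \<open>a\<close> fixed, the induction hypothesis turns the
  others into coefficients \<open>x\<close>. The substitution by the Szego step then absorbs
  \<open>(1 - |a|^2)^N\<close>, which is exactly the weight of index \<open>N + 1\<close>.\<close>

lemma nn_integral_alpha_to_x:
  assumes "g \<in> borel_measurable (lebesgue_CN N)"
  shows "(\<integral>\<^sup>+ \<alpha>. g (alpha_to_x N \<alpha>) \<partial>alpha_measure N) =
    (\<integral>\<^sup>+ x. indicator (alpha_to_x N ` polydisc N) x * g x \<partial>lebesgue_CN N)"
  using assms
proof (induction N arbitrary: g)
  case 0
  show ?case
    by (simp add: alpha_to_x_0 [abs_def])
      (simp add: alpha_measure_def lebesgue_CN_def PiM_empty nn_integral_count_space_finite)
next
  case (Suc N)
  let ?S = "Suc N"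
  define w where "w = (\<lambda>(n::nat) a. ennreal ((1 - (cmod a)\<^sup>2) ^ (n - 1)) * indicator (ball 0 1) a)"
  have w [measurable]: "w n \<in> borel_measurable borel" for n
  proof -
    have "ball (0 :: complex) 1 \<in> sets borel" by simp
    then show ?thesis unfolding w_def by measurable
  qed
  interpret A: product_sigma_finite "\<lambda>n. density lborel (w n)"
    using product_sigma_finite_alpha by (simp add: w_def)
  have alpha: "alpha_measure n = Pi\<^sub>M {1..n} (\<lambda>n. density lborel (w n))" for n
    by (simp add: alpha_measure_def w_def)
  interpret L: sigma_finite_measure "lebesgue_CN N" by (rule sigma_finite_lebesgue_CN)
  define D where "D = (\<lambda>n. alpha_to_x n ` polydisc n)"
  have [measurable]: "D n \<in> sets (lebesgue_CN n)" for n unfolding D_def by (rule sets_alpha_to_x_image)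
  note [measurable] = Suc.prems
  have upd [measurable]: "(\<lambda>p. (snd p)(?S := fst p)) \<in> borel \<Otimes>\<^sub>M lebesgue_CN N \<rightarrow>\<^sub>M lebesgue_CN ?S"
    by (rule measurable_upd_lebesgue_CN) auto
  have stepupd [measurable]:
    "(\<lambda>p. (szego_step N (fst p) (snd p))(?S := fst p)) \<in> borel \<Otimes>\<^sub>M lebesgue_CN N \<rightarrow>\<^sub>M lebesgue_CN ?S"
    by (rule measurable_upd_lebesgue_CN) auto
  have gx: "(\<lambda>\<alpha>. g (alpha_to_x ?S \<alpha>)) \<in> borel_measurable (Pi\<^sub>M (insert ?S {1..N}) (\<lambda>n. density lborel (w n)))"
    unfolding insert_Suc_atLeast1AtMost[symmetric] alpha[symmetric] by measurable
  have gs: "(\<lambda>x. g ((szego_step N a x)(?S := a))) \<in> borel_measurable (lebesgue_CN N)" for a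
    using measurable_compose[OF measurable_Pair1' measurable_compose[OF stepupd Suc.prems], of a]
    by (simp only: fst_conv snd_conv space_borel UNIV_I)
  have inner: "(\<integral>\<^sup>+ v. g (alpha_to_x ?S (v(?S := a))) \<partial>alpha_measure N) =
      (\<integral>\<^sup>+ x. indicator (D N) x * g ((szego_step N a x)(?S := a)) \<partial>lebesgue_CN N)" for a
  proof -
    have "alpha_to_x N (v(?S := a)) = alpha_to_x N v" for v
      by (rule alpha_to_x_cong) auto
    then have "(\<integral>\<^sup>+ v. g (alpha_to_x ?S (v(?S := a))) \<partial>alpha_measure N) =
        (\<integral>\<^sup>+ v. g ((szego_step N a (alpha_to_x N v))(?S := a)) \<partial>alpha_measure N)"
      by (simp add: alpha_to_x_Suc)
    also have "\<dots> = (\<integral>\<^sup>+ x. indicator (D N) x * g ((szego_step N a x)(?S := a)) \<partial>lebesgue_CN N)"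
      unfolding D_def using gs by (rule Suc.IH)
    finally show ?thesis .
  qed
  have subst: "w ?S a * (\<integral>\<^sup>+ x. indicator (D N) x * g ((szego_step N a x)(?S := a)) \<partial>lebesgue_CN N) =
      (\<integral>\<^sup>+ y. indicator (D ?S) (y(?S := a)) * g (y(?S := a)) \<partial>lebesgue_CN N)" for a
  proof (cases "cmod a < 1")
    case a: True
    define G where "G = (\<lambda>y. indicator (D ?S) (y(?S := a)) * g (y(?S := a)))"
    have "(\<lambda>w. indicator (D ?S) w * g w) \<in> borel_measurable (lebesgue_CN ?S)" by measurable
    from measurable_compose[OF measurable_Pair1' measurable_compose[OF upd this], of a]
    have G: "G \<in> borel_measurable (lebesgue_CN N)" by (simp only: G_def fst_conv snd_conv space_borel UNIV_I)
    have "(\<integral>\<^sup>+ x. indicator (D N) x * g ((szego_step N a x)(?S := a)) \<partial>lebesgue_CN N) =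
        (\<integral>\<^sup>+ x. G (szego_step N a x) \<partial>lebesgue_CN N)"
    \<comment> \<open>For \<open>|a| < 1\<close> a point lies in \<open>D N\<close> exactly when its
      image under the step, with \<open>a\<close> appended, lies in \<open>D ?S\<close>.\<close>
    proof (rule nn_integral_cong)
      fix x assume "x \<in> space (lebesgue_CN N)"
      then have "x \<in> complex_space N" by (simp add: space_lebesgue_CN)
      from szego_step_mem_image_iff[OF this, of a] a
      show "indicator (D N) x * g ((szego_step N a x)(?S := a)) = G (szego_step N a x)"
        by (simp add: G_def D_def indicator_def)
    qed
    moreover have "ennreal ((1 - (cmod a)\<^sup>2) ^ N) * (\<integral>\<^sup>+ x. G (szego_step N a x) \<partial>lebesgue_CN N) =
        (\<integral>\<^sup>+ y. G y \<partial>lebesgue_CN N)"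
    proof -
      \<comment> \<open>The involution is the reversal \<open>k \<mapsto> Suc N - k\<close> of
        \<open>{1..N}\<close>.\<close>
      have "ennreal ((1 - (cmod a)\<^sup>2) ^ card {1..N}) *
          (\<integral>\<^sup>+ x. G (\<lambda>k\<in>{1..N}. x k + a * cnj (x (Suc N - k))) \<partial>Pi\<^sub>M {1..N} (\<lambda>_. lborel)) =
        (\<integral>\<^sup>+ y. G y \<partial>Pi\<^sub>M {1..N} (\<lambda>_. lborel))"
        by (rule nn_integral_PiM_add_cnj) (use a G in \<open>auto simp: lebesgue_CN_def\<close>)
      then show ?thesis by (simp add: lebesgue_CN_def szego_step_def)
    qed
    ultimately show ?thesis using a by (simp add: w_def G_def)
  next
    case False
    \<comment> \<open>Off the disc both sides vanish: the weight on the left, and the indicator on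
      the right because a top coefficient lies in the disc.\<close>
    then have "y(?S := a) \<notin> D ?S" for y unfolding D_def alpha_to_x_image_Suc by simp
    then show ?thesis using False by (simp add: w_def)
  qed
  have "(\<integral>\<^sup>+ \<alpha>. g (alpha_to_x ?S \<alpha>) \<partial>alpha_measure ?S) =
      (\<integral>\<^sup>+ a. \<integral>\<^sup>+ v. g (alpha_to_x ?S (v(?S := a))) \<partial>alpha_measure N \<partial>density lborel (w ?S))"
    unfolding alpha insert_Suc_atLeast1AtMost
    by (rule A.product_nn_integral_insert_rev[OF _ _ gx]) auto
  also have "\<dots> = (\<integral>\<^sup>+ a. w ?S a * (\<integral>\<^sup>+ x. indicator (D N) x * g ((szego_step N a x)(?S := a)) \<partial>lebesgue_CN N) \<partial>lborel)"
  proof -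
    have "(\<lambda>p. indicator (D N) (snd p) * g ((szego_step N (fst p) (snd p))(?S := fst p))) \<in> borel_measurable (borel \<Otimes>\<^sub>M lebesgue_CN N)"
      by measurable
    then have "(\<lambda>a. \<integral>\<^sup>+ x. indicator (D N) x * g ((szego_step N a x)(?S := a)) \<partial>lebesgue_CN N) \<in> borel_measurable borel"
      by (intro L.borel_measurable_nn_integral) (simp add: case_prod_beta')
    then show ?thesis unfolding inner by (intro nn_integral_density) auto
  qed
  also have "\<dots> = (\<integral>\<^sup>+ a. \<integral>\<^sup>+ y. indicator (D ?S) (y(?S := a)) * g (y(?S := a)) \<partial>lebesgue_CN N \<partial>lborel)"
    by (simp add: subst)
  also have "\<dots> = (\<integral>\<^sup>+ x. indicator (D ?S) x * g x \<partial>lebesgue_CN ?S)"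
    by (rule nn_integral_lebesgue_CN_Suc(1)[symmetric]) measurable
  finally show ?case by (simp add: D_def)
qed

section \<open>The measure in the Taylor coefficients of the logarithm\<close>

lemma coord_polynomial_measurable:
  "coord_polynomial {1..N} p \<Longrightarrow> p \<in> borel_measurable (lebesgue_CN N)"
  by (induction rule: coord_polynomial.induct) (auto intro: measurable_coord_lebesgue_CN)

lemma polynomial_map_f_to_x: "polynomial_map N (f_to_x N)"
  unfolding polynomial_map_def f_to_x_eq using coord_polynomial_exp_coeffs by simp

lemma measurable_coeffs_maps [measurable]:
  "f_to_x N \<in> lebesgue_CN N \<rightarrow>\<^sub>M lebesgue_CN N"
  "(\<lambda>x. \<lambda>n\<in>{1..N}. log_coeffs x n) \<in> lebesgue_CN N \<rightarrow>\<^sub>M lebesgue_CN N"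
proof -
  have "(\<lambda>f. \<lambda>n\<in>{1..N}. exp_coeffs f n) \<in> lebesgue_CN N \<rightarrow>\<^sub>M lebesgue_CN N"
    using coord_polynomial_measurable[OF coord_polynomial_exp_coeffs, of _ N]
    unfolding lebesgue_CN_def by (intro measurable_restrict) auto
  then show "f_to_x N \<in> lebesgue_CN N \<rightarrow>\<^sub>M lebesgue_CN N"
    unfolding f_to_x_eq [abs_def] .
  show "(\<lambda>x. \<lambda>n\<in>{1..N}. log_coeffs x n) \<in> lebesgue_CN N \<rightarrow>\<^sub>M lebesgue_CN N"
    using coord_polynomial_measurable[OF coord_polynomial_log_coeffs, of _ N]
    unfolding lebesgue_CN_def by (intro measurable_restrict) auto
qed

lemma f_to_x_log_coeffs:
  assumes "x \<in> complex_space N"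
  shows "f_to_x N (\<lambda>n\<in>{1..N}. log_coeffs x n) = x"
proof
  fix n
  show "f_to_x N (\<lambda>n\<in>{1..N}. log_coeffs x n) n = x n"
  proof (cases "n \<in> {1..N}")
    case True
    then have "exp_coeffs (\<lambda>n\<in>{1..N}. log_coeffs x n) n = x n"
      by (intro exp_coeffs_log_coeffs) auto
    with True show ?thesis by (simp add: f_to_x_eq)
  next
    case False
    with assms show ?thesis by (auto simp: f_to_x_eq PiE_def extensional_def)
  qed
qed

lemma log_coeffs_f_to_x:
  assumes "f \<in> complex_space N"
  shows "(\<lambda>n\<in>{1..N}. log_coeffs (f_to_x N f) n) = f"
proof
  fix n
  show "(\<lambda>n\<in>{1..N}. log_coeffs (f_to_x N f) n) n = f n"
  proof (cases "n \<in> {1..N}")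
    case True
    then have "log_coeffs (f_to_x N f) n = f n"
      by (intro log_coeffs_exp_coeffs) (auto simp: f_to_x_eq)
    with True show ?thesis by simp
  next
    case False
    with assms show ?thesis by (auto simp: PiE_def extensional_def)
  qed
qed

lemma bij_betw_f_to_x: "bij_betw (f_to_x N) (complex_space N) (complex_space N)"
  by (rule bij_betw_byWitness[where f' = "\<lambda>x. \<lambda>n\<in>{1..N}. log_coeffs x n"])
    (auto simp: log_coeffs_f_to_x f_to_x_log_coeffs simp del: One_nat_def, auto simp: f_to_x_eq)

text \<open>For fixed lower coordinates the last one is mapped by
  \<open>t \<mapsto> - s v - t\<close>, which preserves area. After this substitution the last
  coordinate is decoupled and the induction hypothesis handles the rest.\<close>

lemma nn_integral_f_to_x:
  assumes "g \<in> borel_measurable (lebesgue_CN N)"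
  shows "(\<integral>\<^sup>+ f. g (f_to_x N f) \<partial>lebesgue_CN N) = (\<integral>\<^sup>+ x. g x \<partial>lebesgue_CN N)"
  using assms
proof (induction N arbitrary: g)
  case 0
  have "f_to_x 0 f = (\<lambda>_. undefined)" for f by (simp add: f_to_x_def fun_eq_iff)
  then show ?case
    by (simp add: lebesgue_CN_def PiM_empty nn_integral_count_space_finite)
next
  case (Suc N)
  let ?S = "Suc N"
  define s where "s = (\<lambda>v. (\<Sum>k<N. of_nat (Suc k) * v (Suc k) * exp_coeffs v (N - k)) / of_nat ?S)"
  define h where "h = (\<lambda>w t. g (w(?S := t)))"
  have "(\<lambda>p. (fst p)(?S := snd p)) \<in> lebesgue_CN N \<Otimes>\<^sub>M borel \<rightarrow>\<^sub>M lebesgue_CN ?S"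
    by (rule measurable_upd_lebesgue_CN) auto
  from measurable_compose[OF this Suc.prems]
  have h: "(\<lambda>p. h (fst p) (snd p)) \<in> borel_measurable (lebesgue_CN N \<Otimes>\<^sub>M borel)"
    by (simp only: h_def)
  have upd: "f_to_x ?S (v(?S := t)) = (f_to_x N v)(?S := - s v - t)" for v t
  proof
    fix n
    have le: "exp_coeffs (v(?S := t)) k = exp_coeffs v k" if "k \<le> N" for k
      using that by (intro exp_coeffs_cong) auto
    have S: "exp_coeffs (v(?S := t)) ?S = - s v - t"
    proof -
      have "(\<Sum>k<N. of_nat (Suc k) * (v(?S := t)) (Suc k) * exp_coeffs (v(?S := t)) (N - k)) =
        (\<Sum>k<N. of_nat (Suc k) * v (Suc k) * exp_coeffs v (N - k))"
        by (intro sum.cong refl) (simp add: le)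
      then show ?thesis
        unfolding exp_coeffs.simps(2) s_def by (simp del: of_nat_Suc)
    qed
    consider "n \<in> {1..N}" | "n = ?S" | "n \<notin> {1..?S}" by fastforce
    then show "f_to_x ?S (v(?S := t)) n = ((f_to_x N v)(?S := - s v - t)) n"
      by cases (auto simp: f_to_x_eq le S)
  qed
  have inner: "(\<integral>\<^sup>+ t. h (f_to_x N v) (- s v - t) \<partial>lborel) = (\<integral>\<^sup>+ t. h (f_to_x N v) t \<partial>lborel)"
    if "v \<in> space (lebesgue_CN N)" for v
  proof -
    have "f_to_x N v \<in> space (lebesgue_CN N)"
      by (auto simp: f_to_x_eq space_lebesgue_CN)
    then have "h (f_to_x N v) \<in> borel_measurable borel"
      using measurable_Pair2[OF h] by simp
    \<comment> \<open>The scaling factor -1 enters squared and disappears.\<close>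
    from nn_integral_complex_affine[OF this, of "-1" "- s v"] show ?thesis by simp
  qed
  have "(\<integral>\<^sup>+ f. g (f_to_x ?S f) \<partial>lebesgue_CN ?S) =
      (\<integral>\<^sup>+ v. \<integral>\<^sup>+ t. g (f_to_x ?S (v(?S := t))) \<partial>lborel \<partial>lebesgue_CN N)"
    by (intro nn_integral_lebesgue_CN_Suc(2) measurable_compose[OF measurable_coeffs_maps(1) Suc.prems])
  also have "\<dots> = (\<integral>\<^sup>+ v. \<integral>\<^sup>+ t. h (f_to_x N v) (- s v - t) \<partial>lborel \<partial>lebesgue_CN N)"
    by (simp only: upd h_def)
  also have "\<dots> = (\<integral>\<^sup>+ v. \<integral>\<^sup>+ t. h (f_to_x N v) t \<partial>lborel \<partial>lebesgue_CN N)"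
    by (intro nn_integral_cong inner)
  also have "\<dots> = (\<integral>\<^sup>+ v. \<integral>\<^sup>+ t. h v t \<partial>lborel \<partial>lebesgue_CN N)"
    using h by (intro Suc.IH lborel.borel_measurable_nn_integral) (simp add: case_prod_beta')
  also have "\<dots> = (\<integral>\<^sup>+ x. g x \<partial>lebesgue_CN ?S)"
    unfolding h_def using Suc.prems by (rule nn_integral_lebesgue_CN_Suc(2)[symmetric])
  finally show ?case .
qed

text \<open>The image in the \<open>f\<close> coordinates is the preimage under the bijection
  \<open>f_to_x N\<close> of the image in the \<open>x\<close> coordinates, so its measurability is
  inherited.\<close>

lemma alpha_to_f_image:
  "alpha_to_f N ` polydisc N =
    {f \<in> complex_space N. f_to_x N f \<in> alpha_to_x N ` polydisc N}"
proof (intro equalityI subsetI)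
  fix f assume "f \<in> alpha_to_f N ` polydisc N"
  then show "f \<in> {f \<in> complex_space N. f_to_x N f \<in> alpha_to_x N ` polydisc N}"
    using f_to_x_log_coeffs[OF alpha_to_x_in_space] by (auto simp: alpha_to_f_eq)
next
  fix f assume "f \<in> {f \<in> complex_space N. f_to_x N f \<in> alpha_to_x N ` polydisc N}"
  then obtain \<alpha> where "f \<in> complex_space N" "\<alpha> \<in> polydisc N" "f_to_x N f = alpha_to_x N \<alpha>"
    by auto
  then show "f \<in> alpha_to_f N ` polydisc N"
    using log_coeffs_f_to_x[of f N] by (intro image_eqI[of _ _ \<alpha>]) (auto simp: alpha_to_f_eq)
qed

lemma measurable_alpha_to_f: "alpha_to_f N \<in> lebesgue_CN N \<rightarrow>\<^sub>M lebesgue_CN N"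
  unfolding alpha_to_f_eq [abs_def]
  by (rule measurable_compose[OF measurable_alpha_to_x measurable_coeffs_maps(2)])

lemma sets_alpha_to_f_image: "alpha_to_f N ` polydisc N \<in> sets (lebesgue_CN N)"
  unfolding alpha_to_f_image space_lebesgue_CN[symmetric] by measurable

text \<open>The identity for \<open>x\<close> is applied to \<open>g\<close> composed with the
  logarithm map \<open>L\<close>. Substituting \<open>x = f_to_x N f\<close>, which preserves
  Lebesgue measure, then cancels \<open>L\<close>.\<close>

lemma nn_integral_alpha_to_f:
  assumes [measurable]: "g \<in> borel_measurable (lebesgue_CN N)"
  shows "(\<integral>\<^sup>+ \<alpha>. g (alpha_to_f N \<alpha>) \<partial>alpha_measure N) =
    (\<integral>\<^sup>+ f. indicator (alpha_to_f N ` polydisc N) f * g f \<partial>lebesgue_CN N)"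
proof -
  define L where "L = (\<lambda>x. \<lambda>n\<in>{1..N}. log_coeffs x n)"
  have [measurable]: "L \<in> lebesgue_CN N \<rightarrow>\<^sub>M lebesgue_CN N"
    unfolding L_def by (rule measurable_coeffs_maps)
  define D where "D = alpha_to_x N ` polydisc N"
  have [measurable]: "D \<in> sets (lebesgue_CN N)"
    unfolding D_def by (rule sets_alpha_to_x_image)
  have alpha: "alpha_to_f N \<alpha> = L (alpha_to_x N \<alpha>)" for \<alpha>
    by (simp add: alpha_to_f_eq L_def)
  have "(\<integral>\<^sup>+ \<alpha>. g (alpha_to_f N \<alpha>) \<partial>alpha_measure N) = (\<integral>\<^sup>+ x. indicator D x * g (L x) \<partial>lebesgue_CN N)"
    unfolding D_def alpha by (rule nn_integral_alpha_to_x) measurable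
  also have "\<dots> = (\<integral>\<^sup>+ f. indicator D (f_to_x N f) * g (L (f_to_x N f)) \<partial>lebesgue_CN N)"
    by (rule nn_integral_f_to_x[symmetric]) measurable
  also have "\<dots> = (\<integral>\<^sup>+ f. indicator (alpha_to_f N ` polydisc N) f * g f \<partial>lebesgue_CN N)"
  proof (rule nn_integral_cong)
    fix f assume "f \<in> space (lebesgue_CN N)"
    then have f: "f \<in> complex_space N" by (simp add: space_lebesgue_CN)
    then have "L (f_to_x N f) = f" unfolding L_def by (rule log_coeffs_f_to_x)
    moreover have "f_to_x N f \<in> D \<longleftrightarrow> f \<in> alpha_to_f N ` polydisc N"
      using f unfolding alpha_to_f_image D_def by simp
    ultimately show "indicator D (f_to_x N f) * g (L (f_to_x N f)) =
        indicator (alpha_to_f N ` polydisc N) f * g f"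
      by (simp add: indicator_def)
  qed
  finally show ?thesis .
qed

section \<open>From integral identities to equalities of measures\<close>

lemma distr_eq_density_indicatorI:
  assumes [measurable]: "f \<in> M \<rightarrow>\<^sub>M N" "D \<in> sets N"
    and eq: "\<And>g. g \<in> borel_measurable N \<Longrightarrow>
      (\<integral>\<^sup>+ x. g (f x) \<partial>M) = (\<integral>\<^sup>+ y. indicator D y * g y \<partial>N)"
  shows "distr M N f = density N (indicator D)"
proof (rule measure_eqI)
  fix A assume "A \<in> sets (distr M N f)"
  then have A [measurable]: "A \<in> sets N" by simp
  have "emeasure (distr M N f) A = (\<integral>\<^sup>+ y. indicator A y \<partial>distr M N f)"
    by simp
  also have "\<dots> = (\<integral>\<^sup>+ x. indicator A (f x) \<partial>M)"
    by (rule nn_integral_distr) measurable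
  also have "\<dots> = emeasure (density N (indicator D)) A"
    by (simp add: eq emeasure_density)
  finally show "emeasure (distr M N f) A = emeasure (density N (indicator D)) A" .
qed simp

theorem theorem4p1:
  fixes N :: nat
  assumes "N \<ge> 1"
  shows
    "(bij_betw (f_to_x N) (complex_space N) (complex_space N) \<and>
      polynomial_map N (f_to_x N) \<and>
      distr (lebesgue_CN N) (lebesgue_CN N) (f_to_x N) = lebesgue_CN N) \<and>
     distr (alpha_measure N) (lebesgue_CN N) (alpha_to_x N) =
       density (lebesgue_CN N) (indicator (alpha_to_x N ` polydisc N)) \<and>
     distr (alpha_measure N) (lebesgue_CN N) (alpha_to_f N) =
       density (lebesgue_CN N) (indicator (alpha_to_f N ` polydisc N))"
proof -
  \<comment> \<open>The image is the whole space here, so the characteristic function is constantly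
    1 and the density is trivial.\<close>
  have "distr (lebesgue_CN N) (lebesgue_CN N) (f_to_x N) =
      density (lebesgue_CN N) (indicator (space (lebesgue_CN N)))"
    by (rule distr_eq_density_indicatorI)
      (auto simp: nn_integral_f_to_x intro!: nn_integral_cong)
  also have "\<dots> = density (lebesgue_CN N) (\<lambda>_. 1)"
    by (intro density_cong) auto
  also have "\<dots> = lebesgue_CN N" by (rule density_1)
  finally have "distr (lebesgue_CN N) (lebesgue_CN N) (f_to_x N) = lebesgue_CN N" .
  moreover have "distr (alpha_measure N) (lebesgue_CN N) (alpha_to_x N) =
      density (lebesgue_CN N) (indicator (alpha_to_x N ` polydisc N))"
    by (rule distr_eq_density_indicatorI[OF _ sets_alpha_to_x_image nn_integral_alpha_to_x]) measurable
  moreover have "distr (alpha_measure N) (lebesgue_CN N) (alpha_to_f N) =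
      density (lebesgue_CN N) (indicator (alpha_to_f N ` polydisc N))"
    using measurable_alpha_to_f
    by (intro distr_eq_density_indicatorI[OF _ sets_alpha_to_f_image nn_integral_alpha_to_f])
      (simp_all add: measurable_cong_sets[OF sets_alpha_measure refl])
  ultimately show ?thesis
    using bij_betw_f_to_x polynomial_map_f_to_x by blast
qed

end
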